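(* Let $\psi:\mathfrak n^+\to\mathbb C$ be a Lie algebra homomorphism with $\psi(d_1)\neq 0$ and $\psi(d_2)\neq 0$. For any $\xi\in\mathbb C$, the $\mathcal V$-module $L_{\psi,\xi}=M_\psi/(z-\xi)M_\psi$ is simple.
   Context: The Virasoro algebra is the complex Lie algebra $\mathcal V$ with basis $\{z\}\cup\{d_k : k\in\mathbb Z\}$ and bracket $[d_k,d_j]=(j-k)d_{k+j}+\delta_{j,-k}\frac{k^3-k}{12}z$, $[z,d_k]=0$. Let $\mathfrak n^+=\mathrm{span}_{\mathbb C}\{d_1,d_2,\dots\}$, a Lie subalgebra. $U(\cdot)$ denotes the universal enveloping algebra. For a Lie algebra homomorphism $\psi:\mathfrak n^+\to\mathbb C$, let $\mathbb C_\psi$ be the one-dimensional $\mathfrak n^+$-module on which $x\in\mathfrak n^+$ acts by the scalar $\psi(x)$, and let $M_\psi=U(\mathcal V)\otimes_{U(\mathfrak n^+)}\mathbb C_\psi$ (the universal Whittaker module of type $\psi$). For $\xi\in\mathbb C$ set $L_{\psi,\xi}=M_\psi/(z-\xi)M_\psi$. *)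

theory Defs
  imports "HOL-Algebra.Algebra" "HOL-Algebra.Algebraic_Closure_Type"
begin

section \<open>Complex vector spaces, Lie algebras and their modules\<close>

abbreviation complex_ring :: "complex ring"
  where "complex_ring \<equiv> ring_of_type_algebra"

text \<open>The record type of modules extends that of rings; its fields \<open>mult\<close> and \<open>one\<close> play no role
  for a module and are left unspecified.\<close>

definition mk_module ::
  "'m set \<Rightarrow> ('m \<Rightarrow> 'm \<Rightarrow> 'm) \<Rightarrow> 'm \<Rightarrow> ('r \<Rightarrow> 'm \<Rightarrow> 'm) \<Rightarrow> ('r, 'm) module"
  where "mk_module C ad z sm =
    \<lparr>carrier = C, monoid.mult = undefined, one = undefined, ring.zero = z, add = ad, module.smult = sm\<rparr>"

record 'g lie_alg = "(complex, 'g) module" +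
  lie_bracket :: "'g \<Rightarrow> 'g \<Rightarrow> 'g"

locale lie_algebra = module complex_ring G for G :: "('g, 'a) lie_alg_scheme" (structure) +
  assumes bracket_closed:
      "\<lbrakk>x \<in> carrier G; y \<in> carrier G\<rbrakk> \<Longrightarrow> lie_bracket G x y \<in> carrier G"
    and bracket_add_left:
      "\<lbrakk>x \<in> carrier G; y \<in> carrier G; w \<in> carrier G\<rbrakk>
        \<Longrightarrow> lie_bracket G (x \<oplus> y) w = lie_bracket G x w \<oplus> lie_bracket G y w"
    and bracket_add_right:
      "\<lbrakk>x \<in> carrier G; y \<in> carrier G; w \<in> carrier G\<rbrakk>
        \<Longrightarrow> lie_bracket G w (x \<oplus> y) = lie_bracket G w x \<oplus> lie_bracket G w y"
    and bracket_smult_left: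
      "\<lbrakk>x \<in> carrier G; y \<in> carrier G\<rbrakk>
        \<Longrightarrow> lie_bracket G (c \<odot> x) y = c \<odot> lie_bracket G x y"
    and bracket_smult_right:
      "\<lbrakk>x \<in> carrier G; y \<in> carrier G\<rbrakk>
        \<Longrightarrow> lie_bracket G x (c \<odot> y) = c \<odot> lie_bracket G x y"
    and bracket_alternating: "x \<in> carrier G \<Longrightarrow> lie_bracket G x x = \<zero>"
    and bracket_jacobi:
      "\<lbrakk>x \<in> carrier G; y \<in> carrier G; w \<in> carrier G\<rbrakk>
        \<Longrightarrow> lie_bracket G x (lie_bracket G y w) \<oplus> lie_bracket G y (lie_bracket G w x)
              \<oplus> lie_bracket G w (lie_bracket G x y) = \<zero>"

definition lie_hom :: "('g, 'a) lie_alg_scheme \<Rightarrow> ('h, 'b) lie_alg_scheme \<Rightarrow> ('g \<Rightarrow> 'h) \<Rightarrow> bool"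
  where "lie_hom G H f \<longleftrightarrow>
    f \<in> carrier G \<rightarrow> carrier H \<and>
    (\<forall>x\<in>carrier G. \<forall>y\<in>carrier G. f (x \<oplus>\<^bsub>G\<^esub> y) = f x \<oplus>\<^bsub>H\<^esub> f y) \<and>
    (\<forall>c. \<forall>x\<in>carrier G. f (c \<odot>\<^bsub>G\<^esub> x) = c \<odot>\<^bsub>H\<^esub> f x) \<and>
    (\<forall>x\<in>carrier G. \<forall>y\<in>carrier G. f (lie_bracket G x y) = lie_bracket H (f x) (f y))"

definition complex_line :: "(complex, complex) module"
  where "complex_line = mk_module UNIV (+) 0 (*)"

definition complex_lie :: "complex lie_alg"
  where "complex_lie = module.extend complex_line (lie_alg.fields (\<lambda>_ _. 0))"

locale lie_module = lie_algebra G + M?: module complex_ring M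
  for G :: "('g, 'a) lie_alg_scheme" (structure)
    and M :: "(complex, 'm, 'b) module_scheme" (structure)
    and act :: "'g \<Rightarrow> 'm \<Rightarrow> 'm" +
  assumes act_closed:
      "\<lbrakk>x \<in> carrier G; v \<in> carrier M\<rbrakk> \<Longrightarrow> act x v \<in> carrier M"
    and act_add_left:
      "\<lbrakk>x \<in> carrier G; y \<in> carrier G; v \<in> carrier M\<rbrakk>
        \<Longrightarrow> act (x \<oplus>\<^bsub>G\<^esub> y) v = act x v \<oplus>\<^bsub>M\<^esub> act y v"
    and act_add_right:
      "\<lbrakk>x \<in> carrier G; v \<in> carrier M; w \<in> carrier M\<rbrakk>
        \<Longrightarrow> act x (v \<oplus>\<^bsub>M\<^esub> w) = act x v \<oplus>\<^bsub>M\<^esub> act x w"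
    and act_smult_left:
      "\<lbrakk>x \<in> carrier G; v \<in> carrier M\<rbrakk> \<Longrightarrow> act (c \<odot>\<^bsub>G\<^esub> x) v = c \<odot>\<^bsub>M\<^esub> act x v"
    and act_smult_right:
      "\<lbrakk>x \<in> carrier G; v \<in> carrier M\<rbrakk> \<Longrightarrow> act x (c \<odot>\<^bsub>M\<^esub> v) = c \<odot>\<^bsub>M\<^esub> act x v"
    and act_bracket:
      "\<lbrakk>x \<in> carrier G; y \<in> carrier G; v \<in> carrier M\<rbrakk>
        \<Longrightarrow> act (lie_bracket G x y) v = act x (act y v) \<ominus>\<^bsub>M\<^esub> act y (act x v)"

definition lie_submodule ::
  "'m set \<Rightarrow> ('g, 'a) lie_alg_scheme \<Rightarrow> (complex, 'm, 'b) module_scheme \<Rightarrow> ('g \<Rightarrow> 'm \<Rightarrow> 'm) \<Rightarrow> bool"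
  where "lie_submodule N G M act \<longleftrightarrow>
    submodule N complex_ring M \<and> (\<forall>x\<in>carrier G. \<forall>v\<in>N. act x v \<in> N)"

definition simple_lie_module ::
  "('g, 'a) lie_alg_scheme \<Rightarrow> (complex, 'm, 'b) module_scheme \<Rightarrow> ('g \<Rightarrow> 'm \<Rightarrow> 'm) \<Rightarrow> bool"
  where "simple_lie_module G M act \<longleftrightarrow>
    lie_module G M act \<and> carrier M \<noteq> {\<zero>\<^bsub>M\<^esub>} \<and>
    (\<forall>N. lie_submodule N G M act \<longrightarrow> N = {\<zero>\<^bsub>M\<^esub>} \<or> N = carrier M)"


section \<open>The universal enveloping algebra\<close>

datatype 'a free_monoid = Word (letters: "'a list")

instantiation free_monoid :: (type) monoid_add
begin

definition "0 = Word []"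
definition "v + w = Word (letters v @ letters w)"

instance
  by standard (simp_all add: zero_free_monoid_def plus_free_monoid_def)

end

text \<open>The multiplication of finitely supported functions on a monoid is convolution, so this is the
  free associative unital algebra of noncommutative polynomials in the elements of \<open>A\<close>.\<close>

definition free_algebra :: "'g set \<Rightarrow> ('g free_monoid \<Rightarrow>\<^sub>0 complex) ring"
  where "free_algebra A =
    ring_of_type_algebra \<lparr>carrier := {p. \<forall>w\<in>Poly_Mapping.keys p. set (letters w) \<subseteq> A}\<rparr>"

definition free_gen :: "'g \<Rightarrow> 'g free_monoid \<Rightarrow>\<^sub>0 complex"
  where "free_gen x = Poly_Mapping.single (Word [x]) 1"

definition free_scalar :: "complex \<Rightarrow> 'g free_monoid \<Rightarrow>\<^sub>0 complex"
  where "free_scalar c = Poly_Mapping.single 0 c"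

text \<open>The tensor algebra of a vector space is the free algebra on its underlying set modulo the
  first two families of relators; the third family then cuts out the enveloping algebra.\<close>

definition uea_relators :: "('g, 'a) lie_alg_scheme \<Rightarrow> ('g free_monoid \<Rightarrow>\<^sub>0 complex) set"
  where "uea_relators G =
    {free_gen (x \<oplus>\<^bsub>G\<^esub> y) - (free_gen x + free_gen y) |x y. x \<in> carrier G \<and> y \<in> carrier G} \<union>
    {free_gen (c \<odot>\<^bsub>G\<^esub> x) - free_scalar c * free_gen x |c x. x \<in> carrier G} \<union>
    {free_gen x * free_gen y - free_gen y * free_gen x - free_gen (lie_bracket G x y) |x y.
      x \<in> carrier G \<and> y \<in> carrier G}"

definition uea_ideal :: "('g, 'a) lie_alg_scheme \<Rightarrow> ('g free_monoid \<Rightarrow>\<^sub>0 complex) set"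
  where "uea_ideal G = genideal (free_algebra (carrier G)) (uea_relators G)"

definition uea :: "('g, 'a) lie_alg_scheme \<Rightarrow> ('g free_monoid \<Rightarrow>\<^sub>0 complex) set ring"
  where "uea G = free_algebra (carrier G) Quot uea_ideal G"

definition uea_class ::
  "('g, 'a) lie_alg_scheme \<Rightarrow> ('g free_monoid \<Rightarrow>\<^sub>0 complex) \<Rightarrow> ('g free_monoid \<Rightarrow>\<^sub>0 complex) set"
  where "uea_class G p = uea_ideal G +>\<^bsub>free_algebra (carrier G)\<^esub> p"

text \<open>For a Lie subalgebra \<open>H\<close> of \<open>G\<close>, the ring homomorphism \<open>U(H) \<rightarrow> U(G)\<close> induced by the inclusion:
  it sends the class of \<open>p\<close> in \<open>U(H)\<close> to the class of \<open>p\<close> in \<open>U(G)\<close>.\<close>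

definition uea_inclusion ::
  "('g, 'a) lie_alg_scheme \<Rightarrow> ('g free_monoid \<Rightarrow>\<^sub>0 complex) set \<Rightarrow> ('g free_monoid \<Rightarrow>\<^sub>0 complex) set"
  where "uea_inclusion G P = (\<Union>p\<in>P. uea_class G p)"

definition free_algebra_act ::
  "(complex, 'm, 'b) module_scheme \<Rightarrow> ('g \<Rightarrow> 'm \<Rightarrow> 'm) \<Rightarrow> ('g free_monoid \<Rightarrow>\<^sub>0 complex) \<Rightarrow> 'm \<Rightarrow> 'm"
  where "free_algebra_act M act p v =
    finsum M (\<lambda>w. Poly_Mapping.lookup p w \<odot>\<^bsub>M\<^esub> foldr act (letters w) v) (Poly_Mapping.keys p)"

text \<open>A Lie module as a module over the enveloping algebra. The action of a class is evaluated on its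
  representatives, all of which act in the same way.\<close>

definition uea_module ::
  "(complex, 'm, 'b) module_scheme \<Rightarrow> ('g \<Rightarrow> 'm \<Rightarrow> 'm) \<Rightarrow> (('g free_monoid \<Rightarrow>\<^sub>0 complex) set, 'm) module"
  where "uea_module M act = mk_module (carrier M) (add M) \<zero>\<^bsub>M\<^esub>
    (\<lambda>P v. the_elem ((\<lambda>p. free_algebra_act M act p v) ` P))"

text \<open>Conversely, a module over the enveloping algebra as a Lie module: its underlying complex vector
  space and the action of the Lie algebra on it.\<close>

definition lie_space ::
  "('g, 'a) lie_alg_scheme \<Rightarrow> (('g free_monoid \<Rightarrow>\<^sub>0 complex) set, 'm, 'b) module_scheme
    \<Rightarrow> (complex, 'm) module"
  where "lie_space G M = mk_module (carrier M) (add M) \<zero>\<^bsub>M\<^esub>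
    (\<lambda>c v. uea_class G (free_scalar c) \<odot>\<^bsub>M\<^esub> v)"

definition lie_act ::
  "('g, 'a) lie_alg_scheme \<Rightarrow> (('g free_monoid \<Rightarrow>\<^sub>0 complex) set, 'm, 'b) module_scheme
    \<Rightarrow> 'g \<Rightarrow> 'm \<Rightarrow> 'm"
  where "lie_act G M x v = uea_class G (free_gen x) \<odot>\<^bsub>M\<^esub> v"


section \<open>Quotient modules and extension of scalars over noncommutative rings\<close>

definition quot_module :: "('r, 'm, 'b) module_scheme \<Rightarrow> 'm set \<Rightarrow> ('r, 'm set) module"
  where "quot_module M N = mk_module (a_rcosets\<^bsub>M\<^esub> N) (set_add M) N
    (\<lambda>r Y. \<Union>y\<in>Y. N +>\<^bsub>M\<^esub> (r \<odot>\<^bsub>M\<^esub> y))"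

text \<open>For a ring homomorphism \<open>\<phi>\<close> from \<open>R\<close> to \<open>S\<close> and a left \<open>R\<close>-module \<open>N\<close>, the left \<open>S\<close>-module
  \<open>S \<otimes>\<^sub>R N\<close>, where \<open>S\<close> is a right \<open>R\<close>-module via \<open>\<phi>\<close>: the free abelian group on the pairs \<open>(s, n)\<close>
  modulo the subgroup of the tensor relations.\<close>

definition tensor_free ::
  "('s, 'a) ring_scheme \<Rightarrow> ('r, 'n, 'b) module_scheme \<Rightarrow> ('s, ('s \<times> 'n) \<Rightarrow>\<^sub>0 int) module"
  where "tensor_free S N =
    mk_module (carrier (free_Abelian_group (carrier S \<times> carrier N))) (+) 0
      (\<lambda>s. frag_extend (\<lambda>(s', n). frag_of (s \<otimes>\<^bsub>S\<^esub> s', n)))"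

definition tensor_relators ::
  "('r \<Rightarrow> 's) \<Rightarrow> ('r, 'a) ring_scheme \<Rightarrow> ('s, 'b) ring_scheme \<Rightarrow> ('r, 'n, 'c) module_scheme
    \<Rightarrow> (('s \<times> 'n) \<Rightarrow>\<^sub>0 int) set"
  where "tensor_relators \<phi> R S N =
    {frag_of (s \<oplus>\<^bsub>S\<^esub> s', n) - (frag_of (s, n) + frag_of (s', n)) |s s' n.
      s \<in> carrier S \<and> s' \<in> carrier S \<and> n \<in> carrier N} \<union>
    {frag_of (s, n \<oplus>\<^bsub>N\<^esub> n') - (frag_of (s, n) + frag_of (s, n')) |s n n'.
      s \<in> carrier S \<and> n \<in> carrier N \<and> n' \<in> carrier N} \<union>
    {frag_of (s \<otimes>\<^bsub>S\<^esub> \<phi> r, n) - frag_of (s, r \<odot>\<^bsub>N\<^esub> n) |s r n.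
      s \<in> carrier S \<and> r \<in> carrier R \<and> n \<in> carrier N}"

definition extend_scalars ::
  "('r \<Rightarrow> 's) \<Rightarrow> ('r, 'a) ring_scheme \<Rightarrow> ('s, 'b) ring_scheme \<Rightarrow> ('r, 'n, 'c) module_scheme
    \<Rightarrow> ('s, (('s \<times> 'n) \<Rightarrow>\<^sub>0 int) set) module"
  where "extend_scalars \<phi> R S N = quot_module (tensor_free S N)
    (generate (free_Abelian_group (carrier S \<times> carrier N)) (tensor_relators \<phi> R S N))"


section \<open>The Virasoro algebra\<close>

datatype vir_basis = Z | D int

type_synonym vir = "vir_basis \<Rightarrow>\<^sub>0 complex"

definition vir_z :: vir
  where "vir_z = Poly_Mapping.single Z 1"

definition vir_d :: "int \<Rightarrow> vir"
  where "vir_d k = Poly_Mapping.single (D k) 1"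

definition vir_scale :: "complex \<Rightarrow> vir \<Rightarrow> vir"
  where "vir_scale c = Poly_Mapping.map ((*) c)"

fun vir_basis_bracket :: "vir_basis \<Rightarrow> vir_basis \<Rightarrow> vir"
  where
    "vir_basis_bracket (D k) (D j) =
      vir_scale (of_int (j - k)) (vir_d (k + j)) +
      (if j = - k then vir_scale ((of_int k ^ 3 - of_int k) / 12) vir_z else 0)"
  | "vir_basis_bracket Z _ = 0"
  | "vir_basis_bracket _ Z = 0"

definition vir_bracket :: "vir \<Rightarrow> vir \<Rightarrow> vir"
  where "vir_bracket x y =
    (\<Sum>a\<in>Poly_Mapping.keys x. \<Sum>b\<in>Poly_Mapping.keys y.
      vir_scale (Poly_Mapping.lookup x a * Poly_Mapping.lookup y b) (vir_basis_bracket a b))"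

definition virasoro :: "vir lie_alg"
  where "virasoro = module.extend (mk_module UNIV (+) 0 vir_scale) (lie_alg.fields vir_bracket)"

definition n_plus :: "vir lie_alg"
  where "n_plus = virasoro \<lparr>carrier := module.span vir_scale {vir_d k |k. k \<ge> 1}\<rparr>"


lemma cring_complex_ring: "cring complex_ring" by (rule cring_from_type_algebra)

lemma lookup_vir_scale: "Poly_Mapping.lookup (vir_scale c x) a = c * Poly_Mapping.lookup x a"
  by (simp add: vir_scale_def Poly_Mapping.map.rep_eq when_def)

lemma vir_scale_simps:
  "vir_scale c (x + y) = vir_scale c x + vir_scale c y"
  "vir_scale (c + d) x = vir_scale c x + vir_scale d x"
  "vir_scale c (vir_scale d x) = vir_scale (c * d) x"
  "vir_scale c 0 = 0" "vir_scale 1 x = x" "vir_scale 0 x = 0"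
  by (auto intro!: poly_mapping_eqI simp: lookup_vir_scale lookup_add algebra_simps)

lemma vir_scale_single: "vir_scale c (Poly_Mapping.single a d) = Poly_Mapping.single a (c * d)"
  by (auto intro!: poly_mapping_eqI simp: lookup_vir_scale lookup_single when_def)

interpretation vir: vector_space vir_scale
  by standard (simp_all add: vir_scale_simps)

lemma vir_bracket_superset:
  assumes "finite A" "finite B" "Poly_Mapping.keys x \<subseteq> A" "Poly_Mapping.keys y \<subseteq> B"
  shows "vir_bracket x y = (\<Sum>a\<in>A. \<Sum>b\<in>B.
      vir_scale (Poly_Mapping.lookup x a * Poly_Mapping.lookup y b) (vir_basis_bracket a b))"
proof -
  have "vir_bracket x y = (\<Sum>a\<in>A. \<Sum>b\<in>Poly_Mapping.keys y.
      vir_scale (Poly_Mapping.lookup x a * Poly_Mapping.lookup y b) (vir_basis_bracket a b))"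
    unfolding vir_bracket_def
    by (rule sum.mono_neutral_left) (use assms in \<open>auto simp: in_keys_iff vir_scale_simps\<close>)
  also have "\<dots> = (\<Sum>a\<in>A. \<Sum>b\<in>B.
      vir_scale (Poly_Mapping.lookup x a * Poly_Mapping.lookup y b) (vir_basis_bracket a b))"
    by (intro sum.cong refl sum.mono_neutral_left) (use assms in \<open>auto simp: in_keys_iff vir_scale_simps\<close>)
  finally show ?thesis .
qed

lemma vir_bracket_add_left: "vir_bracket (x + y) w = vir_bracket x w + vir_bracket y w"
proof -
  let ?A = "Poly_Mapping.keys x \<union> Poly_Mapping.keys y" and ?B = "Poly_Mapping.keys w"
  have "Poly_Mapping.keys (x + y) \<subseteq> ?A" by (rule keys_add)
  then show ?thesis
    by (simp add: vir_bracket_superset[of ?A ?B] lookup_add distrib_right vir_scale_simps sum.distrib)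
qed

lemma vir_bracket_add_right: "vir_bracket w (x + y) = vir_bracket w x + vir_bracket w y"
proof -
  let ?A = "Poly_Mapping.keys x \<union> Poly_Mapping.keys y" and ?B = "Poly_Mapping.keys w"
  have "Poly_Mapping.keys (x + y) \<subseteq> ?A" by (rule keys_add)
  then show ?thesis
    by (simp add: vir_bracket_superset[of ?B ?A] lookup_add distrib_left vir_scale_simps sum.distrib)
qed

lemma keys_vir_scale: "Poly_Mapping.keys (vir_scale c x) \<subseteq> Poly_Mapping.keys x"
  by (auto simp: in_keys_iff lookup_vir_scale)

lemma vir_bracket_scale_left: "vir_bracket (vir_scale c x) y = vir_scale c (vir_bracket x y)"
  by (simp add: vir_bracket_superset[of "Poly_Mapping.keys x" "Poly_Mapping.keys y"] keys_vir_scale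
      lookup_vir_scale vir.scale_sum_right mult_ac)

lemma vir_bracket_scale_right: "vir_bracket x (vir_scale c y) = vir_scale c (vir_bracket x y)"
  by (simp add: vir_bracket_superset[of "Poly_Mapping.keys x" "Poly_Mapping.keys y"] keys_vir_scale
      lookup_vir_scale vir.scale_sum_right mult_ac)

lemma vir_bracket_single:
  "vir_bracket (Poly_Mapping.single a c) (Poly_Mapping.single b d) =
    vir_scale (c * d) (vir_basis_bracket a b)"
  by (simp add: vir_bracket_superset[of "{a}" "{b}"])

lemma vir_bracket_0: "vir_bracket 0 y = 0" "vir_bracket x 0 = 0"
  by (simp_all add: vir_bracket_def)

lemma vir_bracket_basis:
  "vir_bracket (vir_d k) (vir_d j) = vir_scale (of_int (j - k)) (vir_d (k + j)) +
      (if j = - k then vir_scale ((of_int k ^ 3 - of_int k) / 12) vir_z else 0)"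
  "vir_bracket vir_z x = 0" "vir_bracket x vir_z = 0"
  using vir_bracket_single[of "D k" 1 "D j" 1]
    apply (simp add: vir_d_def vir_scale_simps)
   apply (simp add: vir_bracket_def vir_z_def vir_scale_simps)
  apply (simp add: vir_bracket_def vir_z_def vir_scale_simps)
  apply (rule sum.neutral)
  subgoal
    apply auto
    subgoal for a by (cases a) (auto simp: vir_scale_simps)
    done
  done

lemma vir_basis_bracket_skew: "vir_basis_bracket a b = - vir_basis_bracket b a"
  by (cases a; cases b)
    (auto intro!: poly_mapping_eqI simp: vir_d_def vir_z_def vir_scale_single lookup_add lookup_single when_def field_simps
        lookup_minus power3_eq_cube add.commute)

lemma vir_bracket_skew: "vir_bracket x y = - vir_bracket y x"
proof -
  have "vir_bracket x y = (\<Sum>a\<in>Poly_Mapping.keys x. \<Sum>b\<in>Poly_Mapping.keys y.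
      - vir_scale (Poly_Mapping.lookup y b * Poly_Mapping.lookup x a) (vir_basis_bracket b a))"
    unfolding vir_bracket_def
    by (intro sum.cong refl) (metis vir_basis_bracket_skew mult.commute vir.scale_minus_right)
  also have "\<dots> = - vir_bracket y x"
    unfolding vir_bracket_def sum_negf by (subst sum.swap) simp
  finally show ?thesis .
qed

lemma vir_sum_basis:
  "(\<Sum>a\<in>Poly_Mapping.keys x. vir_scale (Poly_Mapping.lookup x a) (Poly_Mapping.single a 1)) = x"
  by (rule poly_mapping_eqI)
    (auto simp: lookup_sum vir_scale_single lookup_single when_def in_keys_iff)

lemma vir_basis_induct:
  fixes x :: vir
  assumes "\<And>a. P (Poly_Mapping.single a 1)" "\<And>x y. P x \<Longrightarrow> P y \<Longrightarrow> P (x + y)"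
    "\<And>c x. P x \<Longrightarrow> P (vir_scale c x)"
  shows "P x"
proof -
  have "P 0" using assms(3)[OF assms(1), of 0 Z] by (simp add: vir_scale_simps)
  have "P (\<Sum>a\<in>A. vir_scale (f a) (Poly_Mapping.single a 1))" if "finite A" for f A
    using that \<open>P 0\<close> by (induction A rule: finite_induct) (auto intro: assms)
  from this[of "Poly_Mapping.keys x" "Poly_Mapping.lookup x"] show ?thesis
    by (simp add: vir_sum_basis)
qed

lemma vir_jacobi_basis:
  fixes a b c :: vir_basis
  defines "x \<equiv> Poly_Mapping.single a 1" and "y \<equiv> Poly_Mapping.single b 1" and "w \<equiv> Poly_Mapping.single c 1"
  shows "vir_bracket x (vir_bracket y w) + vir_bracket y (vir_bracket w x) + vir_bracket w (vir_bracket x y) = 0"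
proof -
  show ?thesis
  proof (cases a; cases b; cases c)
    fix k j l assume *: "a = D k" "b = D j" "c = D l"
    have xyw: "x = vir_d k" "y = vir_d j" "w = vir_d l"
      by (simp_all add: x_def y_def w_def vir_d_def *)
    have br: "vir_bracket (vir_d k) (vir_bracket (vir_d j) (vir_d l)) =
       vir_scale (of_int ((l-j)*(j+l-k))) (vir_d (k+j+l)) +
       (if k + j + l = 0 then vir_scale (of_int (l-j) * (of_int k ^ 3 - of_int k) / 12) vir_z else 0)" for k j l
    proof -
      have "vir_bracket (vir_d k) (vir_bracket (vir_d j) (vir_d l)) =
          vir_scale (of_int (l - j)) (vir_bracket (vir_d k) (vir_d (j + l)))"
        by (auto simp: vir_bracket_basis(1)[of j l] vir_bracket_add_right vir_bracket_scale_right
            vir_bracket_basis(3) vir_bracket_0 vir_scale_simps)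
      moreover have "j + l = - k \<longleftrightarrow> k + j + l = 0" by auto
      ultimately show ?thesis
        by (simp only: vir_bracket_basis(1)[of k "j + l"]) (simp add: vir_scale_simps add.assoc)
    qed
    show ?thesis
    proof (cases "k + j + l = 0")
      case True
      then have l: "l = - k - j" by simp
      show ?thesis unfolding xyw br using True
        by (auto intro!: poly_mapping_eqI simp: l vir_d_def vir_z_def vir_scale_single lookup_add lookup_single when_def
            algebra_simps power3_eq_cube add_divide_distrib diff_divide_distrib)
    next
      case False
      then show ?thesis unfolding xyw br
        by (auto intro!: poly_mapping_eqI simp: vir_d_def vir_z_def vir_scale_single lookup_add lookup_single when_def
            algebra_simps)
    qed
  qed (simp_all add: x_def y_def w_def vir_bracket_basis vir_bracket_0 flip: vir_z_def)
qed

lemma vir_jacobi: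
  "vir_bracket x (vir_bracket y w) + vir_bracket y (vir_bracket w x) + vir_bracket w (vir_bracket x y) = 0"
proof -
  define J where "J x y w = vir_bracket x (vir_bracket y w) + vir_bracket y (vir_bracket w x) +
    vir_bracket w (vir_bracket x y)" for x y w
  have rot: "J x y w = J y w x" for x y w
    by (simp add: J_def add_ac)
  have add: "J (x + x') y w = J x y w + J x' y w" for x x' y w
    unfolding J_def vir_bracket_add_left vir_bracket_add_right by (simp only: add_ac)
  have scale: "J (vir_scale c x) y w = vir_scale c (J x y w)" for c x y w
    unfolding J_def vir_bracket_scale_left vir_bracket_scale_right by (simp only: vir_scale_simps)
  have 1: "(\<And>a. J (Poly_Mapping.single a 1) y w = 0) \<Longrightarrow> J x y w = 0" for x y w
    by (rule vir_basis_induct[of "\<lambda>x. J x y w = 0"]) (simp_all add: add scale vir_scale_simps)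
  have "J x y w = 0"
    by (rule 1, subst rot, rule 1, subst rot, rule 1, subst rot)
       (use vir_jacobi_basis in \<open>simp add: J_def\<close>)
  then show ?thesis by (simp add: J_def)
qed

lemma vir_fields:
  "carrier virasoro = UNIV" "add virasoro = (+)" "ring.zero virasoro = 0" "module.smult virasoro = vir_scale"
  "lie_bracket virasoro = vir_bracket"
  by (simp_all add: virasoro_def mk_module_def module.defs lie_alg.defs)

lemma lie_algebra_virasoro: "lie_algebra virasoro"
proof -
  have neg: "x = - x \<Longrightarrow> x = 0" for x :: vir
    by (auto intro!: poly_mapping_eqI dest!: arg_cong[of _ _ Poly_Mapping.lookup] simp: fun_eq_iff)
  have ag: "abelian_group virasoro"
    by (rule abelian_groupI) (auto simp: vir_fields add_ac intro: exI[of _ "- x" for x])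
  show ?thesis
    unfolding lie_algebra_def
  proof
    show "module complex_ring virasoro"
      by (rule moduleI[OF cring_complex_ring ag]) (simp_all add: vir_fields ring_of_type_algebra_def vir_scale_simps)
    show "lie_algebra_axioms virasoro"
      by standard (auto simp: vir_fields vir_bracket_add_left vir_bracket_add_right vir_bracket_scale_left
          vir_bracket_scale_right vir_jacobi intro: neg vir_bracket_skew)
  qed
qed

lemma n_plus_keys: "x \<in> carrier n_plus \<longleftrightarrow> Poly_Mapping.keys x \<subseteq> D ` {1..}"
proof
  show "Poly_Mapping.keys x \<subseteq> D ` {1..}" if "x \<in> carrier n_plus"
  proof -
    have "x \<in> vir.span {vir_d k |k. k \<ge> 1}" using that by (simp add: n_plus_def)
    then show ?thesis
    proof (induction rule: vir.span_induct_alt)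
      case (step c x y)
      then show ?case
        using keys_add[of "vir_scale c x" y] keys_vir_scale[of c x] by (force simp: vir_d_def)
    qed simp
  qed
  show "x \<in> carrier n_plus" if *: "Poly_Mapping.keys x \<subseteq> D ` {1..}"
  proof -
    have "x = (\<Sum>a\<in>Poly_Mapping.keys x. vir_scale (Poly_Mapping.lookup x a) (Poly_Mapping.single a 1))"
      by (simp add: vir_sum_basis)
    also have "\<dots> \<in> vir.span {vir_d k |k. k \<ge> 1}"
      by (intro vir.span_sum vir.span_scale vir.span_base) (use * in \<open>auto simp: vir_d_def\<close>)
    finally show ?thesis by (simp add: n_plus_def)
  qed
qed

lemma vir_bracket_n_plus:
  assumes "x \<in> carrier n_plus" "y \<in> carrier n_plus"
  shows "vir_bracket x y \<in> carrier n_plus"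
proof -
  have "vir_scale (Poly_Mapping.lookup x a * Poly_Mapping.lookup y b) (vir_basis_bracket a b)
      \<in> vir.span {vir_d k |k. k \<ge> 1}"
    if ab: "a \<in> Poly_Mapping.keys x" "b \<in> Poly_Mapping.keys y" for a b
  proof -
    obtain k j where "a = D k" "b = D j" "k \<ge> 1" "j \<ge> 1"
      using assms ab by (force simp: n_plus_keys)
    then have "vir_basis_bracket a b = vir_scale (of_int (j - k)) (vir_d (k + j))" "k + j \<ge> 1"
      by simp_all
    then show ?thesis
      by (simp only:, intro vir.span_scale vir.span_base) auto
  qed
  then show ?thesis
    unfolding vir_bracket_def n_plus_def by (auto intro!: vir.span_sum)
qed

lemma lie_algebra_n_plus: "lie_algebra n_plus"
proof -
  have f: "add n_plus = (+)" "ring.zero n_plus = 0" "module.smult n_plus = vir_scale"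
    "lie_bracket n_plus = vir_bracket"
    using vir_fields by (simp_all add: n_plus_def)
  have c: "carrier n_plus = vir.span {vir_d k |k. k \<ge> 1}"
    by (simp add: n_plus_def)
  interpret V: lie_algebra virasoro by (rule lie_algebra_virasoro)
  have ag: "abelian_group n_plus"
  proof (rule abelian_groupI)
    show "\<exists>y\<in>carrier n_plus. y \<oplus>\<^bsub>n_plus\<^esub> x = \<zero>\<^bsub>n_plus\<^esub>" if "x \<in> carrier n_plus" for x
      using that by (intro bexI[of _ "- x"]) (auto simp: f c intro: vir.span_neg)
  qed (auto simp: f c add_ac intro: vir.span_add vir.span_zero)
  show ?thesis
    unfolding lie_algebra_def
  proof
    show "module complex_ring n_plus"
      by (rule moduleI[OF cring_complex_ring ag])
        (auto simp: f c ring_of_type_algebra_def vir_scale_simps intro: vir.span_scale)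
    show "lie_algebra_axioms n_plus"
      using V.bracket_alternating V.bracket_jacobi
      by unfold_locales (auto simp: f vir_fields vir_bracket_add_left vir_bracket_add_right vir_bracket_scale_left
          vir_bracket_scale_right vir_bracket_n_plus)
  qed
qed


section \<open>Whittaker modules\<close>

type_synonym vir_uea = "(vir free_monoid \<Rightarrow>\<^sub>0 complex) set"

definition whittaker_line :: "(vir \<Rightarrow> complex) \<Rightarrow> (vir_uea, complex) module"
  where "whittaker_line \<psi> = uea_module complex_line (\<lambda>x c. \<psi> x * c)"

definition universal_whittaker ::
  "(vir \<Rightarrow> complex) \<Rightarrow> (vir_uea, ((vir_uea \<times> complex) \<Rightarrow>\<^sub>0 int) set) module"
  where "universal_whittaker \<psi> =
    extend_scalars (uea_inclusion virasoro) (uea n_plus) (uea virasoro) (whittaker_line \<psi>)"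

definition z_minus :: "complex \<Rightarrow> vir_uea"
  where "z_minus \<xi> = uea_class virasoro (free_gen vir_z) \<ominus>\<^bsub>uea virasoro\<^esub>
    uea_class virasoro (free_scalar \<xi>)"

definition whittaker_quotient ::
  "(vir \<Rightarrow> complex) \<Rightarrow> complex \<Rightarrow> (vir_uea, ((vir_uea \<times> complex) \<Rightarrow>\<^sub>0 int) set set) module"
  where "whittaker_quotient \<psi> \<xi> = quot_module (universal_whittaker \<psi>)
    ((\<lambda>m. z_minus \<xi> \<odot>\<^bsub>universal_whittaker \<psi>\<^esub> m) ` carrier (universal_whittaker \<psi>))"

end

theory Submission
  imports Defs
begin

text \<open>
  Let \<open>w\<close> be the generator of \<open>L\<^sub>\<psi>\<^sub>,\<^sub>\<xi>\<close>, so that \<open>d\<^sub>j w = \<psi>(d\<^sub>j) w\<close> for \<open>j \<ge> 1\<close> and \<open>z\<close> acts as \<open>\<xi>\<close>.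
  The module is spanned by the monomials \<open>d_{-a} \<cdots> d_{-b} w\<close> with \<open>a, \<dots>, b \<ge> 0\<close>. Give
  \<open>d_{-m}\<close> the degree \<open>m + 2\<close> and let \<open>Fil N\<close> be spanned by the monomials of degree at most \<open>N\<close>.
  A commutator \<open>[d_{-a}, d_{-b}]\<close> has degree two less than the product, so the leading part of a
  vector is a polynomial in commuting variables \<open>x\<^sub>m\<close>, one for each \<open>d_{-m}\<close>. For \<open>j \<ge> 1\<close> the operator
  \<open>E\<^sub>j = d\<^sub>j - \<psi>(d\<^sub>j)\<close> kills \<open>w\<close> and lowers the degree by \<open>j\<close>. On leading parts \<open>E_{m+2}\<close> is a
  derivation: it sends \<open>x\<^sub>m\<close> to \<open>-(2m+2) \<psi>(d\<^sub>2)\<close>, because \<open>[d_{m+2}, d_{-m}]\<close> is a multiple of \<open>d\<^sub>2\<close>,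
  and it kills \<open>x\<^sub>i\<close> for every \<open>i < m\<close> and for \<open>i = m + 1\<close>; here \<open>\<psi>(d\<^sub>k) = 0\<close> for \<open>k \<ge> 3\<close> enters.
  So if \<open>m\<close> is the largest index that occurs in the leading part of \<open>v\<close>, then \<open>E_{m+2}\<close> acts on that
  leading part as a nonzero multiple of \<open>\<partial>/\<partial>x\<^sub>m\<close>, and \<open>E_{m+2} v\<close> again has a nonzero leading part.
  Iteration ends at a nonzero multiple of \<open>w\<close>. Hence a submodule that contains a nonzero vector
  contains \<open>w\<close>, and so it is everything.

  This reduction is carried out in \<open>whittaker_data\<close>, not in the module itself but in the free algebra
  modulo the left ideal \<open>J\<close> of the elements that annihilate \<open>w\<close>. What is known about \<open>w\<close> then takes the
  form of a list of elements of \<open>J\<close>, and the leading part is a formal combination of sorted monomials; the result is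
  \<open>w_in_invariant_subspace\<close>.

  What remains is that \<open>w\<close> is not zero. For this a linear functional on words in the basis
  of the Virasoro algebra is constructed that is compatible with the commutation relations, takes
  the value 1 on the empty word and satisfies \<open>f (l d\<^sub>k) = \<psi>(d\<^sub>k) f l\<close> for \<open>k \<ge> 1\<close> and
  \<open>f (l z) = \<xi> f l\<close>. It is defined by sorting words, and it is well defined by the Jacobi identity;
  this is the part of the theorem of Poincare, Birkhoff and Witt that the argument calls for
  (\<open>whittaker_functional_exchange\<close>, \<open>whittaker_functional_append\<close>). The functional factors through
  the tensor product and through the quotient by \<open>z - \<xi>\<close>, which gives \<open>one_notin_z_image\<close>.

  Finally, every element of \<open>M\<^sub>\<psi>\<close> has the form \<open>p \<otimes> 1\<close> with \<open>p\<close> in the free algebra on the vectors of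
  the Virasoro algebra (\<open>carrier_M\<close>). So \<open>L\<^sub>\<psi>\<^sub>,\<^sub>\<xi>\<close> is the free algebra modulo \<open>J\<close>, and its submodules
  correspond to the left ideals that contain \<open>J\<close>.
\<close>

section \<open>Leading parts of vectors in a Whittaker module\<close>

text \<open>The operators \<open>d k\<close> satisfy the relations of the Virasoro algebra with central charge \<open>\<xi>\<close>, and \<open>w\<close> is a
  Whittaker vector, only modulo \<open>J\<close>. The locale thus describes the quotient by \<open>J\<close> through
  representatives, which allows it to be applied to the free algebra, where all calculations take
  place in a type.\<close>
locale whittaker_data = vector_space scale
  for scale :: "complex \<Rightarrow> 'v::ab_group_add \<Rightarrow> 'v" (infixr \<open>*s\<close> 75) +
  fixes J :: "'v set" and d :: "int \<Rightarrow> 'v \<Rightarrow> 'v" and w :: 'v and \<psi> :: "int \<Rightarrow> complex" and \<xi> :: complex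
  assumes subspace_J: "subspace J"
    and d_add: "d k (u + v) = d k u + d k v"
    and d_scale: "d k (c *s v) = c *s d k v"
    and d_J: "v \<in> J \<Longrightarrow> d k v \<in> J"
    and d_commutator: "d k (d j v) - d j (d k v) -
        (of_int (j - k) *s d (k + j) v + (if j = - k then ((of_int k ^ 3 - of_int k) / 12 * \<xi>) *s v else 0)) \<in> J"
    and d_w: "k \<ge> 1 \<Longrightarrow> d k w - \<psi> k *s w \<in> J"
    and \<psi>_eq_0: "k \<ge> 3 \<Longrightarrow> \<psi> k = 0"
    and \<psi>_2: "\<psi> 2 \<noteq> 0"
begin

fun mon :: "nat list \<Rightarrow> 'v"
  where
    "mon [] = w"
  | "mon (m # l) = d (- int m) (mon l)"

text \<open>The summand 2 makes commutators of the \<open>d (- m)\<close> drop in degree, and it is also the largest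
  \<open>k\<close> with \<open>\<psi> k \<noteq> 0\<close>, so that replacing \<open>d 2 w\<close> by \<open>\<psi> 2 *s w\<close> does not raise the degree.\<close>
fun deg :: "nat list \<Rightarrow> int"
  where
    "deg [] = 0"
  | "deg (m # l) = int m + 2 + deg l"

definition Fil :: "int \<Rightarrow> 'v set"
  where "Fil N = span ({mon l |l. deg l \<le> N} \<union> J)"

definition E :: "int \<Rightarrow> 'v \<Rightarrow> 'v"
  where "E j v = d j v - \<psi> j *s v"

lemma d_0: "d k 0 = 0"
  using d_add[of k 0 0] by simp

lemma d_diff: "d k (u - v) = d k u - d k v"
  using d_add[of k "u - v" v] by simp

lemma E_add: "E j (u + v) = E j u + E j v"
  by (simp add: E_def d_add scale_right_distrib)

lemma E_scale: "E j (c *s v) = c *s E j v"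
  by (simp add: E_def d_scale scale_right_diff_distrib mult.commute)

lemma E_0: "E j 0 = 0" by (simp add: E_def d_0)

lemma E_diff: "E j (u - v) = E j u - E j v"
  using E_add[of j "u - v" v] by simp

lemma E_sum: "E j (sum f A) = (\<Sum>a\<in>A. E j (f a))"
  by (induction A rule: infinite_finite_induct) (simp_all add: E_0 E_add)

lemma E_J: "v \<in> J \<Longrightarrow> E j v \<in> J"
  unfolding E_def using subspace_J d_J by (auto intro: subspace_diff subspace_scale)

lemma d_eq_E: "d j v = E j v + \<psi> j *s v" by (simp add: E_def)

lemma deg_nonneg: "deg l \<ge> 0" by (induction l) auto

lemma subspace_Fil: "subspace (Fil N)" by (simp add: Fil_def)

lemma mon_Fil: "deg l \<le> N \<Longrightarrow> mon l \<in> Fil N"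
  unfolding Fil_def by (rule span_base) auto

lemma J_Fil: "v \<in> J \<Longrightarrow> v \<in> Fil N"
  unfolding Fil_def by (rule span_base) auto

lemma Fil_mono: "v \<in> Fil M \<Longrightarrow> M \<le> N \<Longrightarrow> v \<in> Fil N"
  unfolding Fil_def by (rule subsetD[OF span_mono]) auto

lemma Fil_add: "u \<in> Fil N \<Longrightarrow> v \<in> Fil N \<Longrightarrow> u + v \<in> Fil N"
  using subspace_Fil subspace_add by blast

lemma Fil_scale: "v \<in> Fil N \<Longrightarrow> c *s v \<in> Fil N"
  using subspace_Fil subspace_scale by blast

lemma Fil_0: "0 \<in> Fil N"
  using subspace_Fil subspace_0 by blast

lemma Fil_sum: "(\<And>a. a \<in> A \<Longrightarrow> f a \<in> Fil N) \<Longrightarrow> sum f A \<in> Fil N"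
  by (rule subspace_sum[OF subspace_Fil])

lemma Fil_negative: "N < 0 \<Longrightarrow> Fil N = J"
proof -
  assume "N < 0"
  then have "{mon l |l. deg l \<le> N} = {}" using deg_nonneg by (auto simp: not_le intro: less_le_trans)
  then show ?thesis using span_eq_iff[of J] subspace_J unfolding Fil_def by simp
qed

text \<open>The form in which the filtration is used: a linear map may be tested on monomials and on \<open>J\<close>.\<close>
lemma Fil_induct_linear:
  assumes "v \<in> Fil N" "subspace S"
    and "\<And>u v. h (u + v) = h u + h v" "\<And>c v. h (c *s v) = c *s h v"
    and "\<And>l. deg l \<le> N \<Longrightarrow> h (mon l) \<in> S" "\<And>v. v \<in> J \<Longrightarrow> h v \<in> S"
  shows "h v \<in> S"
proof -
  have "h 0 = 0" using assms(3)[of 0 0] by simp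
  have "subspace {v. h v \<in> S}"
    by (rule subspaceI) (use assms \<open>h 0 = 0\<close> in \<open>auto intro: subspace_add subspace_scale subspace_0\<close>)
  then have "span ({mon l |l. deg l \<le> N} \<union> J) \<subseteq> {v. h v \<in> S}"
    by (intro span_minimal) (use assms in auto)
  then show ?thesis using assms(1) unfolding Fil_def by auto
qed

lemma d_nonpos_Fil: "v \<in> Fil N \<Longrightarrow> d (- int m) v \<in> Fil (N + int m + 2)"
  by (rule Fil_induct_linear[OF _ subspace_Fil, where h = "d (- int m)"])
     (auto intro!: d_add d_scale J_Fil d_J mon_Fil[of "m # l" for l, simplified])

text \<open>Move \<open>d j\<close> past the first factor \<open>d (- m)\<close>. The commutator is a multiple of \<open>d (j - m)\<close>, which is
  either a further factor of low degree or, for \<open>m < j\<close>, again of the form \<open>E (j - m) + \<psi> (j - m)\<close>.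
  The second summand keeps the degree of the remaining monomial, but it is nonzero only if \<open>j - m \<le> 2\<close>,
  and then the loss of the factor \<open>d (- m)\<close> alone accounts for \<open>m + 2 \<ge> j\<close>.\<close>
lemma E_mon: "j \<ge> 1 \<Longrightarrow> E j (mon l) \<in> Fil (deg l - j)"
proof (induction l arbitrary: j)
  case Nil
  then show ?case using d_w[of j] by (auto simp: E_def intro: J_Fil)
next
  case (Cons m l)
  let ?u = "mon l" and ?N = "deg l + int m + 2 - j"
  let ?z = "if - int m = - j then ((of_int j ^ 3 - of_int j) / 12 * \<xi>) *s ?u else 0"
  let ?r = "d j (d (- int m) ?u) - d (- int m) (d j ?u) - (of_int (- int m - j) *s d (j + - int m) ?u + ?z)"
  have r: "?r \<in> Fil ?N"
    by (rule J_Fil) (use d_commutator[of j "- int m" ?u] in simp)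
  have split: "E j (mon (m # l)) = d (- int m) (E j ?u) + of_int (- int m - j) *s d (j + - int m) ?u + ?z + ?r"
    by (simp add: E_def d_diff d_scale algebra_simps)
  have 1: "d (- int m) (E j ?u) \<in> Fil ?N"
    using d_nonpos_Fil[OF Cons.IH[OF Cons.prems], of m] by (simp add: algebra_simps)
  have 2: "d (j + - int m) ?u \<in> Fil ?N"
  proof (cases "j \<le> int m")
    case True
    then have "d (j + - int m) ?u = mon (nat (int m - j) # l)" by simp
    moreover have "deg (nat (int m - j) # l) \<le> ?N" using True by simp
    ultimately show ?thesis by (metis mon_Fil)
  next
    case False
    let ?i = "j + - int m"
    have "E ?i ?u \<in> Fil (deg l - ?i)" using False by (intro Cons.IH) simp
    then have "E ?i ?u \<in> Fil ?N" by (rule Fil_mono) simp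
    moreover have "\<psi> ?i *s ?u \<in> Fil ?N"
      using \<psi>_eq_0[of ?i] mon_Fil[of l ?N] by (cases "?i \<ge> 3") (auto simp: Fil_0 intro: Fil_scale)
    ultimately show ?thesis by (simp only: d_eq_E Fil_add)
  qed
  have 3: "?z \<in> Fil ?N" by (auto simp: Fil_0 intro!: Fil_scale mon_Fil)
  have "E j (mon (m # l)) \<in> Fil ?N"
    unfolding split by (intro Fil_add Fil_scale 1 2 3 r)
  then show ?case by (simp add: algebra_simps)
qed

lemma E_Fil: "v \<in> Fil N \<Longrightarrow> j \<ge> 1 \<Longrightarrow> E j v \<in> Fil (N - j)"
  by (rule Fil_induct_linear[OF _ subspace_Fil, where h = "E j"])
     (auto simp: E_add E_scale intro: J_Fil E_J Fil_mono[OF E_mon])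

text \<open>On leading parts \<open>E (m + 2)\<close> is the derivation \<open>-(2m+2) \<psi> 2 \<partial>/\<partial>x\<^sub>m\<close> as long as only the variables
  \<open>x\<^sub>i\<close> with \<open>i \<le> m\<close> occur. The list is decreasing, so if \<open>m\<close> occurs at all then it occurs at the head,
  and removing one factor \<open>x\<^sub>m\<close> means taking the tail.\<close>
lemma E_mon_largest_part:
  assumes "sorted_wrt (\<ge>) l" "\<And>b. b \<in> set l \<Longrightarrow> b \<le> m"
  shows "E (int m + 2) (mon l) - (- (2 * of_nat m + 2) * \<psi> 2 * of_nat (count_list l m)) *s mon (tl l)
    \<in> Fil (deg l - int m - 3)"
  using assms
proof (induction l)
  case Nil
  then show ?case using d_w[of "int m + 2"] by (auto simp: E_def intro: J_Fil)
next
  case (Cons b l)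
  let ?u = "mon l" and ?j = "int m + 2" and ?c = "- (2 * of_nat m + 2) * \<psi> 2"
  let ?N = "deg l + int b - int m - 1"
  let ?i = "?j + - int b"
  let ?r = "d ?j (d (- int b) ?u) - d (- int b) (d ?j ?u) - (of_int (- int b - ?j) *s d ?i ?u)"
  note prems = Cons.prems
  have b: "b \<le> m" using Cons.prems by simp
  have r: "?r \<in> Fil ?N"
    by (rule J_Fil) (use d_commutator[of ?j "- int b" ?u] b in \<open>auto split: if_splits\<close>)
  define g where "g = E ?j ?u - (?c * of_nat (count_list l m)) *s mon (tl l)"
  have IH: "g \<in> Fil (deg l - int m - 3)"
    using Cons unfolding g_def by auto
  have g: "d (- int b) g \<in> Fil ?N" using d_nonpos_Fil[OF IH, of b] by (rule Fil_mono) simp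
  have Ei: "E ?i ?u \<in> Fil ?N" by (rule Fil_mono[OF E_mon]) (use b in auto)
  \<comment> \<open>The commutator is a multiple of \<open>d (m + 2 - b) = E (m + 2 - b) + \<psi> (m + 2 - b)\<close>. Since \<open>b \<le> m\<close>, its
    second summand survives only for \<open>b = m\<close>, and the central term does not occur.\<close>
  have split: "E ?j (mon (b # l)) = d (- int b) g
      + (?c * of_nat (count_list l m)) *s d (- int b) (mon (tl l))
      + (of_int (- int b - ?j) *s E ?i ?u + (of_int (- int b - ?j) * \<psi> ?i) *s ?u + ?r)"
    by (simp add: E_def g_def d_diff d_scale) (simp add: algebra_simps)
  have *: "(?c * of_nat (count_list l m)) *s d (- int b) (mon (tl l)) + (of_int (- int b - ?j) * \<psi> ?i) *s ?u
      = (?c * of_nat (count_list (b # l) m)) *s mon l"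
  proof (cases "b = m")
    case False
    then have "\<psi> ?i = 0" "count_list l m = 0"
      using b Cons.prems(1) by (auto intro!: \<psi>_eq_0 simp: count_list_0_iff)
    then show ?thesis using False by simp
  next
    case True
    show ?thesis
    proof (cases l)
      case Nil
      then show ?thesis using True by (simp add: algebra_simps)
    next
      case (Cons a l')
      have "count_list l m = 0" if "a \<noteq> m"
      proof -
        have "a \<le> m" "\<And>x. x \<in> set l \<Longrightarrow> x \<le> a"
          using prems Cons True by auto
        then have "m \<notin> set l" using that by force
        then show ?thesis by (simp add: count_list_0_iff)
      qed
      moreover have "d (- int b) (mon (tl l)) = mon l" if "a = m"
        using that True Cons by simp
      moreover have "of_int (- int b - ?j) * \<psi> ?i = ?c"
        using True by (simp add: algebra_simps)
      moreover have "?c * of_nat (count_list l m) + ?c = ?c * of_nat (count_list (b # l) m)"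
        using True by (simp add: algebra_simps)
      ultimately show ?thesis
        by (cases "a = m") (simp_all only: scale_left_distrib[symmetric] of_nat_0 mult_zero_right scale_zero_left add_0 simp_thms)
    qed
  qed
  have "E ?j (mon (b # l)) - (?c * of_nat (count_list (b # l) m)) *s mon (tl (b # l))
      = d (- int b) g + of_int (- int b - ?j) *s E ?i ?u + ?r"
    unfolding split using * by (simp add: algebra_simps)
  also have "\<dots> \<in> Fil ?N" by (intro Fil_add Fil_scale g Ei r)
  finally show ?case by (simp add: algebra_simps)
qed

lemma mon_swap: "mon (a # b # l) - mon (b # a # l) \<in> Fil (deg (a # b # l) - 1)"
proof -
  let ?u = "mon l"
  let ?x = "of_int (- int b - (- int a)) *s d (- int a + - int b) ?u
     + (if - int b = - (- int a) then ((of_int (- int a) ^ 3 - of_int (- int a)) / 12 * \<xi>) *s ?u else 0)"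
  have eq: "d (- int a + - int b) ?u = mon ((a + b) # l)" by simp
  have "?x \<in> Fil (deg (a # b # l) - 1)"
    unfolding eq by (intro Fil_add Fil_scale mon_Fil) (auto simp: Fil_0 intro!: Fil_scale mon_Fil)
  from Fil_add[OF J_Fil[OF d_commutator[of "- int a" "- int b" ?u]] this] show ?thesis
    by simp
qed

fun insort_desc :: "nat \<Rightarrow> nat list \<Rightarrow> nat list"
  where
    "insort_desc a [] = [a]"
  | "insort_desc a (b # l) = (if a \<ge> b then a # b # l else b # insort_desc a l)"

lemma set_insort_desc: "set (insort_desc a l) = insert a (set l)"
  by (induction l) auto

lemma sorted_insort_desc: "sorted_wrt (\<ge>) l \<Longrightarrow> sorted_wrt (\<ge>) (insort_desc a l)"
  by (induction l) (auto simp: set_insort_desc)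

lemma deg_insort_desc: "deg (insort_desc a l) = deg (a # l)"
  by (induction l) auto

lemma mon_insort_desc: "mon (a # l) - mon (insort_desc a l) \<in> Fil (deg (a # l) - 1)"
proof (induction l)
  case (Cons b l)
  have "mon (b # a # l) - mon (b # insort_desc a l) \<in> Fil (deg (a # b # l) - 1)"
    using d_nonpos_Fil[OF Cons, of b] by (simp add: d_diff algebra_simps)
  from Fil_add[OF mon_swap this] show ?case
    by (simp add: Fil_0)
qed (simp add: Fil_0)

lemma mon_sort: "\<exists>l'. sorted_wrt (\<ge>) l' \<and> deg l' = deg l \<and> mon l - mon l' \<in> Fil (deg l - 1)"
proof (induction l)
  case (Cons a l)
  then obtain l' where l': "sorted_wrt (\<ge>) l'" "deg l' = deg l" "mon l - mon l' \<in> Fil (deg l - 1)" by blast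
  have "mon (a # l) - mon (a # l') \<in> Fil (deg (a # l) - 1)"
    using d_nonpos_Fil[OF l'(3), of a] by (simp add: d_diff algebra_simps)
  moreover have "mon (a # l') - mon (insort_desc a l') \<in> Fil (deg (a # l) - 1)"
    using mon_insort_desc[of a l'] l' by simp
  ultimately have "(mon (a # l) - mon (a # l')) + (mon (a # l') - mon (insort_desc a l')) \<in> Fil (deg (a # l) - 1)"
    by (rule Fil_add)
  then show ?case
    using l' by (intro exI[of _ "insort_desc a l'"]) (simp add: sorted_insort_desc deg_insort_desc)
qed (auto simp: Fil_0 intro!: exI[of _ "[]"])

definition sorted_of_deg :: "int \<Rightarrow> nat list set"
  where "sorted_of_deg N = {l. sorted_wrt (\<ge>) l \<and> deg l = N}"

text \<open>The leading part of a vector, as a formal combination of decreasing lists with nonzero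
  coefficients. It may be empty, and it is not claimed to be unique.\<close>
lemma Fil_top_part:
  assumes "v \<in> Fil N"
  obtains S c where "finite S" "S \<subseteq> sorted_of_deg N" "\<And>l. l \<in> S \<Longrightarrow> c l \<noteq> 0"
    "v - (\<Sum>l\<in>S. c l *s mon l) \<in> Fil (N - 1)"
proof -
  let ?B = "mon ` sorted_of_deg N \<union> Fil (N - 1)"
  have "v \<in> span ?B"
  proof (rule Fil_induct_linear[OF assms, where h = "\<lambda>v. v"])
    fix l assume l: "deg l \<le> N"
    show "mon l \<in> span ?B"
    proof (cases "deg l = N")
      case True
      from mon_sort[of l] obtain l' where l': "l' \<in> sorted_of_deg N" "mon l - mon l' \<in> Fil (N - 1)"
        using True by (auto simp: sorted_of_deg_def)
      have "(mon l - mon l') + mon l' \<in> span ?B"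
        using l' by (intro span_add span_base) auto
      then show ?thesis by simp
    next
      case False
      then show ?thesis using mon_Fil[of l "N - 1"] l by (auto intro: span_base)
    qed
  qed (auto intro: span_base J_Fil)
  then obtain x y where xy: "x \<in> span (mon ` sorted_of_deg N)" "y \<in> Fil (N - 1)" "v = x + y"
    unfolding span_Un using span_eq_iff[THEN iffD2, OF subspace_Fil, of "N - 1"] by auto
  obtain S c where Sc: "finite S" "S \<subseteq> sorted_of_deg N" "x = (\<Sum>l\<in>S. c l *s mon l)"
  proof -
    from xy(1) obtain T r where T: "finite T" "T \<subseteq> mon ` sorted_of_deg N" "x = (\<Sum>a\<in>T. r a *s a)"
      unfolding span_explicit by auto
    then obtain S where S: "S \<subseteq> sorted_of_deg N" "inj_on mon S" "T = mon ` S"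
      by (auto simp: subset_image_inj)
    have "finite S" using T S finite_imageD by blast
    moreover have "x = (\<Sum>l\<in>S. r (mon l) *s mon l)"
      using T(3) S by (simp add: sum.reindex)
    ultimately show ?thesis using S that by auto
  qed
  have "x = (\<Sum>l\<in>{l\<in>S. c l \<noteq> 0}. c l *s mon l)"
    unfolding Sc(3) by (rule sum.mono_neutral_right) (use Sc in auto)
  then have "v - (\<Sum>l\<in>{l\<in>S. c l \<noteq> 0}. c l *s mon l) \<in> Fil (N - 1)"
    using xy(2,3) by simp
  then show ?thesis
    by (rule that[rotated 3]) (use Sc in auto)
qed

text \<open>The induction that drives the proof. With \<open>m\<close> the largest head in the leading part, \<open>E (m + 2)\<close> kills
  the leading terms whose head is smaller and removes the head \<open>m\<close> from the others. Distinct lists with the same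
  head have distinct tails, so no cancellation can occur and the new leading part is again nonempty.\<close>
lemma w_in_of_top_part:
  assumes I: "subspace I" "\<And>k v. v \<in> I \<Longrightarrow> d k v \<in> I" "J \<subseteq> I"
    and v: "v \<in> I" "finite S" "S \<noteq> {}" "S \<subseteq> sorted_of_deg N" "\<And>l. l \<in> S \<Longrightarrow> c l \<noteq> 0"
      "v - (\<Sum>l\<in>S. c l *s mon l) \<in> Fil (N - 1)"
  shows "w \<in> I"
  using v
proof (induction "nat N" arbitrary: N v S c rule: less_induct)
  case less
  have E_I: "E j u \<in> I" if "u \<in> I" for j u
    unfolding E_def using that I by (auto intro: subspace_diff subspace_scale)
  obtain l0 where l0: "l0 \<in> S" using less.prems by blast
  then have "N \<ge> 0" using less.prems deg_nonneg[of l0] by (auto simp: sorted_of_deg_def)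
  show ?case
  proof (cases "N = 0")
    case True
    \<comment> \<open>Every part contributes at least 2 to the degree, so degree 0 leaves a multiple of \<open>w\<close> alone.\<close>
    have "l = []" if "l \<in> S" for l
    proof (cases l)
      case (Cons m l')
      then show ?thesis
        using that True less.prems(4) deg_nonneg[of l'] by (auto simp: sorted_of_deg_def)
    qed
    then have S: "S = {[]}" using less.prems by auto
    then have "v - c [] *s w \<in> I"
      using less.prems(6) True I Fil_negative[of "-1"] by auto
    then have "c [] *s w \<in> I"
      using less.prems(1) I subspace_diff[of I v "v - c [] *s w"] by simp
    then have "inverse (c []) *s (c [] *s w) \<in> I" using I by (blast intro: subspace_scale)
    then show ?thesis using less.prems(5)[of "[]"] S by simp
  next
    case False
    have nonempty: "l \<noteq> []" if "l \<in> S" for l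
      using that False less.prems(4) by (auto simp: sorted_of_deg_def)
    define m where "m = Max (hd ` S)"
    have hd_le: "hd l \<le> m" if "l \<in> S" for l
      unfolding m_def using that less.prems(2) by auto
    have parts: "b \<le> m" if "l \<in> S" "b \<in> set l" for b l
    proof -
      have "sorted_wrt (\<ge>) l" using that less.prems(4) by (auto simp: sorted_of_deg_def)
      then have "b \<le> hd l" using that(2) by (cases l) auto
      then show ?thesis using hd_le[OF that(1)] by simp
    qed
    define S0 where "S0 = {l \<in> S. hd l = m}"
    define c' where "c' l = c (m # l) * (- (2 * of_nat m + 2) * \<psi> 2 * of_nat (count_list (m # l) m))" for l
    have "m \<in> hd ` S" unfolding m_def using less.prems by (intro Max_in) auto
    then have "S0 \<noteq> {}" by (auto simp: S0_def)
    have S0: "l = m # tl l" "l \<in> S" if "l \<in> S0" for l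
      using that nonempty[of l] unfolding S0_def by (cases l; simp)+
    let ?j = "int m + 2" and ?c = "- (2 * of_nat m + 2) * \<psi> 2"
    let ?N = "N - ?j"
    define k where "k l = ?c * of_nat (count_list l m)" for l
    \<comment> \<open>Both error terms, the one of \<open>v\<close> and those of the monomials, stay below the new degree \<open>?N\<close>.\<close>
    have rest: "E ?j (v - (\<Sum>l\<in>S. c l *s mon l)) \<in> Fil (?N - 1)"
      using E_Fil[OF less.prems(6), of ?j] by (rule Fil_mono) simp_all
    have top: "(\<Sum>l\<in>S. c l *s (E ?j (mon l) - k l *s mon (tl l))) \<in> Fil (?N - 1)"
    proof (intro Fil_sum Fil_scale)
      fix l assume l: "l \<in> S"
      then have "sorted_wrt (\<ge>) l" "deg l = N" using less.prems(4) by (auto simp: sorted_of_deg_def)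
      then show "E ?j (mon l) - k l *s mon (tl l) \<in> Fil (?N - 1)"
        using E_mon_largest_part[of l m] parts[OF l] unfolding k_def by (auto intro: Fil_mono)
    qed
    have "(\<Sum>l\<in>S. c l *s k l *s mon (tl l))
        = (\<Sum>l\<in>S0. c l *s k l *s mon (tl l))"
    proof (rule sum.mono_neutral_right)
      show "\<forall>l\<in>S - S0. c l *s k l *s mon (tl l) = 0"
      proof
        fix l assume l: "l \<in> S - S0"
        then have "sorted_wrt (\<ge>) l" using less.prems(4) by (auto simp: sorted_of_deg_def)
        moreover have "hd l < m" "l \<noteq> []" using l hd_le[of l] nonempty by (auto simp: S0_def)
        ultimately have "m \<notin> set l" by (cases l) auto
        then have "count_list l m = 0" by (simp add: count_list_0_iff)
        then show "c l *s k l *s mon (tl l) = 0" by (simp add: k_def)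
      qed
    qed (use less.prems in \<open>auto simp: S0_def\<close>)
    also have "\<dots> = (\<Sum>l\<in>tl ` S0. c' l *s mon l)"
    proof (subst sum.reindex)
      show inj: "inj_on tl S0" using S0 by (metis inj_onI)
      show "(\<Sum>l\<in>S0. c l *s k l *s mon (tl l)) = sum ((\<lambda>l. c' l *s mon l) \<circ> tl) S0"
      proof (intro sum.cong refl)
        fix l assume "l \<in> S0"
        then have "c' (tl l) = c l * k l" using S0(1)[of l] by (simp only: c'_def k_def)
        then show "c l *s k l *s mon (tl l) = ((\<lambda>l. c' l *s mon l) \<circ> tl) l" by simp
      qed
    qed
    finally have lead: "(\<Sum>l\<in>S. c l *s k l *s mon (tl l)) = (\<Sum>l\<in>tl ` S0. c' l *s mon l)" .
    have "E ?j v - (\<Sum>l\<in>tl ` S0. c' l *s mon l) =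
        E ?j (v - (\<Sum>l\<in>S. c l *s mon l))
        + (\<Sum>l\<in>S. c l *s (E ?j (mon l) - k l *s mon (tl l)))"
      unfolding lead[symmetric] E_diff E_sum E_scale sum_subtractf scale_right_diff_distrib by simp
    also have "\<dots> \<in> Fil (?N - 1)" by (rule Fil_add[OF rest top])
    finally have main: "E ?j v - (\<Sum>l\<in>tl ` S0. c' l *s mon l) \<in> Fil (?N - 1)" .
    show ?thesis
    proof (rule less.hyps[OF _ _ _ _ _ _ main])
      show "nat ?N < nat N" using \<open>N \<ge> 0\<close> False by simp
      show "E ?j v \<in> I" by (rule E_I[OF less.prems(1)])
      show "finite (tl ` S0)" using less.prems(2) by (simp add: S0_def)
      show "tl ` S0 \<noteq> {}" using \<open>S0 \<noteq> {}\<close> by simp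
      show "tl ` S0 \<subseteq> sorted_of_deg ?N"
      proof
        fix l assume "l \<in> tl ` S0"
        then have "m # l \<in> S" using S0 by (metis imageE)
        then show "l \<in> sorted_of_deg ?N" using less.prems(4) by (auto simp: sorted_of_deg_def)
      qed
      fix l assume "l \<in> tl ` S0"
      then have "c (m # l) \<noteq> 0" using S0 less.prems(5) by (metis imageE)
      moreover have "of_nat (2 * m + 2) \<noteq> (0 :: complex)" "of_nat (count_list (m # l) m) \<noteq> (0 :: complex)"
        unfolding of_nat_eq_0_iff by simp_all
      ultimately show "c' l \<noteq> 0" using \<psi>_2 unfolding c'_def of_nat_add of_nat_mult of_nat_numeral
        by (simp only: mult_eq_0_iff neg_equal_0_iff_equal simp_thms)
    qed
  qed
qed

text \<open>Descend in the filtration until the leading part is nonempty. This happens before \<open>Fil (- 1) = J\<close> is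
  reached, since \<open>v\<close> is not in \<open>J\<close>.\<close>
lemma w_in_invariant_subspace:
  assumes I: "subspace I" "\<And>k v. v \<in> I \<Longrightarrow> d k v \<in> I" "J \<subseteq> I"
    and v: "v \<in> I" "v \<notin> J" "v \<in> Fil N"
  shows "w \<in> I"
  using v(3)
proof (induction "nat (N + 1)" arbitrary: N rule: less_induct)
  case less
  have "N \<ge> 0" using less.prems v Fil_negative[of N] by force
  obtain S c where S: "finite S" "S \<subseteq> sorted_of_deg N" "\<And>l. l \<in> S \<Longrightarrow> c l \<noteq> 0"
    "v - (\<Sum>l\<in>S. c l *s mon l) \<in> Fil (N - 1)"
    using Fil_top_part[OF less.prems] by metis
  show ?case
  proof (cases "S = {}")
    case True
    show ?thesis by (rule less.hyps[of "N - 1"]) (use S True \<open>N \<ge> 0\<close> in auto)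
  next
    case False
    show ?thesis by (rule w_in_of_top_part[OF I v(1) S(1) False S(2,3,4)])
  qed
qed

lemma d_Fil:
  assumes v: "v \<in> Fil N"
  shows "\<exists>M. d k v \<in> Fil M"
proof (cases "k \<ge> 1")
  case True
  have "E k v + \<psi> k *s v \<in> Fil N"
    by (intro Fil_add Fil_scale v Fil_mono[OF E_Fil[OF v True]]) (use True in simp)
  then have "d k v \<in> Fil N" by (simp only: d_eq_E)
  then show ?thesis ..
next
  case False
  then have "- int (nat (- k)) = k" by simp
  then have "d k v \<in> Fil (N + int (nat (- k)) + 2)" using d_nonpos_Fil[OF v, of "nat (- k)"] by (simp only:)
  then show ?thesis ..
qed

end

section \<open>Linear extension of functions on a basis\<close>

text \<open>The linear functional with the values \<open>h\<close> on the basis. A linear map into functions is written as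
  \<open>\<lambda>u. lin (\<lambda>b. h b u) p\<close>, so that all the linear algebra below is about scalars.\<close>
definition lin :: "('b \<Rightarrow> complex) \<Rightarrow> ('b \<Rightarrow>\<^sub>0 complex) \<Rightarrow> complex"
  where "lin h p = (\<Sum>b\<in>Poly_Mapping.keys p. Poly_Mapping.lookup p b * h b)"

lemma lin_cong [fundef_cong]:
  "p = q \<Longrightarrow> (\<And>b. b \<in> Poly_Mapping.keys q \<Longrightarrow> h b = g b) \<Longrightarrow> lin h p = lin g q"
  by (simp add: lin_def)

lemma lin_superset:
  "finite A \<Longrightarrow> Poly_Mapping.keys p \<subseteq> A \<Longrightarrow> lin h p = (\<Sum>b\<in>A. Poly_Mapping.lookup p b * h b)"
  unfolding lin_def by (rule sum.mono_neutral_left) (auto simp: in_keys_iff)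

lemma lin_add: "lin h (p + q) = lin h p + lin h q"
  using keys_add[of p q]
  by (simp add: lin_superset[of "Poly_Mapping.keys p \<union> Poly_Mapping.keys q"] lookup_add
      distrib_right sum.distrib)

lemma lin_0: "lin h 0 = 0"
  by (simp add: lin_def)

lemma lin_minus: "lin h (- p) = - lin h p"
  using lin_add[of h p "- p"] by (simp add: lin_0 eq_neg_iff_add_eq_0 add.commute)

lemma lin_diff: "lin h (p - q) = lin h p - lin h q"
  using lin_add[of h "p - q" q] by simp

lemma lin_sum: "lin h (sum f A) = (\<Sum>a\<in>A. lin h (f a))"
  by (induction A rule: infinite_finite_induct) (simp_all add: lin_0 lin_add)

lemma lin_single: "lin h (Poly_Mapping.single b c) = c * h b"
  by (simp add: lin_superset[of "{b}"])

lemma lin_vir_scale: "lin h (vir_scale c p) = c * lin h p"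
  by (subst lin_superset[OF _ keys_vir_scale])
    (simp_all add: lin_def lookup_vir_scale sum_distrib_left mult.assoc)

lemma lin_fun_add: "lin (\<lambda>b. h b + g b) p = lin h p + lin g p"
  by (simp add: lin_def distrib_left sum.distrib)

lemma lin_fun_diff: "lin (\<lambda>b. h b - g b) p = lin h p - lin g p"
  by (simp add: lin_def right_diff_distrib sum_subtractf)

lemma lin_fun_mult: "lin (\<lambda>b. c * h b) p = c * lin h p"
  by (simp add: lin_def sum_distrib_left mult.left_commute)

lemma lin_fun_0: "lin (\<lambda>b. 0) p = 0"
  by (simp add: lin_def)

lemma lin_swap: "lin (\<lambda>a. lin (\<lambda>b. h a b) q) p = lin (\<lambda>b. lin (\<lambda>a. h a b) p) q"
proof -
  have "lin (\<lambda>a. lin (\<lambda>b. h a b) q) p = (\<Sum>a\<in>Poly_Mapping.keys p. \<Sum>b\<in>Poly_Mapping.keys q.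
      Poly_Mapping.lookup p a * (Poly_Mapping.lookup q b * h a b))"
    by (simp add: lin_def sum_distrib_left)
  also have "\<dots> = lin (\<lambda>b. lin (\<lambda>a. h a b) p) q"
    by (subst sum.swap) (simp add: lin_def sum_distrib_left mult.left_commute)
  finally show ?thesis .
qed

lemma lin_vir_bracket: "lin h (vir_bracket p q) = lin (\<lambda>b. lin (\<lambda>c. lin h (vir_basis_bracket b c)) q) p"
  unfolding vir_bracket_def lin_sum lin_vir_scale by (simp add: lin_def[of _ p] lin_def[of _ q] sum_distrib_left mult.assoc)

section \<open>A functional on words from the diamond lemma\<close>
text \<open>The order in which words are sorted. The factor 2 leaves room for \<open>Z\<close> between \<open>D 0\<close> and \<open>D 1\<close>, so that
  the positive ranks belong exactly to the basis of \<open>n\<^sup>+ + \<complex> z\<close>, on which a character is given, and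
  these letters come last in a sorted word.\<close>
fun rank :: "vir_basis \<Rightarrow> int"
  where
    "rank (D k) = 2 * k"
  | "rank Z = 1"

lemma rank_inject: "rank x = rank y \<longleftrightarrow> x = y"
  by (cases x; cases y) (auto, presburger+)

fun inversions :: "vir_basis list \<Rightarrow> nat"
  where
    "inversions [] = 0"
  | "inversions (x # l) = length (filter (\<lambda>y. rank y < rank x) l) + inversions l"

lemma inversions_swap: "rank y < rank x \<Longrightarrow> inversions (u @ y # x # v) < inversions (u @ x # y # v)"
  by (induction u) auto

fun first_descent :: "vir_basis list \<Rightarrow> (vir_basis list \<times> vir_basis \<times> vir_basis \<times> vir_basis list) option"
  where
    "first_descent (x # y # l) = (if rank y < rank x then Some ([], x, y, l)
      else map_option (\<lambda>(u, a, b, v). (x # u, a, b, v)) (first_descent (y # l)))"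
  | "first_descent _ = None"

lemma first_descent_None: "first_descent l = None \<longleftrightarrow> sorted_wrt (\<lambda>x y. rank x \<le> rank y) l"
proof (induction l rule: first_descent.induct)
  case (1 x y l)
  then show ?case by (cases "rank y < rank x") (auto intro: order_trans[of _ "rank y"])
qed auto

lemma first_descent_Some:
  "first_descent l = Some (u, x, y, v) \<Longrightarrow> l = u @ x # y # v \<and> rank y < rank x"
proof (induction l arbitrary: u rule: first_descent.induct)
  case (1 a b l)
  then show ?case by (cases "rank b < rank a") auto
qed auto

lemma first_descent_least:
  "first_descent l = Some (u, x, y, v) \<Longrightarrow> l = u' @ x' # y' # v' \<Longrightarrow> rank y' < rank x'
    \<Longrightarrow> length u \<le> length u'"
proof (induction l arbitrary: u u' rule: first_descent.induct)
  case (1 a b l)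
  show ?case
  proof (cases "rank b < rank a")
    case True
    then show ?thesis using 1(2) by simp
  next
    case False
    then obtain u1 where u1: "first_descent (b # l) = Some (u1, x, y, v)" "u = a # u1"
      using 1(2) by auto
    from 1(3) False 1(4) obtain u2 where u2: "u' = a # u2" "b # l = u2 @ x' # y' # v'"
      by (cases u') auto
    show ?thesis using 1(1)[OF False u1(1) u2(2) 1(4)] u1 u2 by simp
  qed
qed auto

text \<open>The value on a sorted word is that of the functional on \<open>U(V)\<close> that vanishes on a
  sorted monomial with a factor \<open>D k\<close>, \<open>k \<le> 0\<close>, and is the character \<open>\<chi>\<close> on the remaining ones. Other words are
  sorted at the first descent. The rewriting either keeps the length and removes an inversion, or
  it shortens the word.\<close>
function whittaker_functional :: "(vir_basis \<Rightarrow> complex) \<Rightarrow> vir_basis list \<Rightarrow> complex"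
  where
    "whittaker_functional \<chi> l = (case first_descent l of
      None \<Rightarrow> if \<forall>b\<in>set l. rank b > 0 then prod_list (map \<chi> l) else 0
    | Some (u, x, y, v) \<Rightarrow> whittaker_functional \<chi> (u @ y # x # v)
        + lin (\<lambda>b. whittaker_functional \<chi> (u @ b # v)) (vir_basis_bracket x y))"
  by auto
termination
  by (relation "measures [length \<circ> snd, inversions \<circ> snd]") (auto dest!: first_descent_Some simp: inversions_swap)

declare whittaker_functional.simps [simp del]

context
  fixes \<chi> :: "vir_basis \<Rightarrow> complex"
begin

abbreviation "wh \<equiv> whittaker_functional \<chi>"

text \<open>By antisymmetry of the bracket it is enough to know the commutation relations at descents.\<close>
lemma exchange_from_descents:
  assumes "\<And>x y. rank y < rank x \<Longrightarrow>
    g (u @ x # y # v) = g (u @ y # x # v) + lin (\<lambda>b. g (u @ b # v)) (vir_basis_bracket x y)"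
  shows "g (u @ x # y # v) - g (u @ y # x # v) = lin (\<lambda>b. g (u @ b # v)) (vir_basis_bracket x y)"
proof -
  consider "rank y < rank x" | "rank x < rank y" | "x = y"
    using rank_inject[of x y] by linarith
  then show ?thesis
  proof cases
    case 1
    then show ?thesis using assms[of y x] by simp
  next
    case 2
    then show ?thesis using assms[of x y]
      by (subst vir_basis_bracket_skew) (simp add: lin_minus)
  next
    case 3
    have "vir_basis_bracket x x = 0" by (cases x) (simp_all add: vir_scale_simps)
    then show ?thesis using 3 by (simp add: lin_0)
  qed
qed

text \<open>The diamond lemma: sorting at any descent gives the same value as sorting at the first one. If
  the two descents are disjoint, the two rewritings commute. If they overlap, in three letters
  \<open>x\<^sub>0 > x > y\<close>, both ways of sorting them end in \<open>y x x\<^sub>0\<close>, and the shorter words that are collected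
  on the way differ by the Jacobi identity for \<open>x\<^sub>0\<close>, \<open>x\<close> and \<open>y\<close>.\<close>
lemma whittaker_functional_exchange_descent:
  "l = u @ x # y # v \<Longrightarrow> rank y < rank x \<Longrightarrow>
    wh (u @ x # y # v) = wh (u @ y # x # v) + lin (\<lambda>b. wh (u @ b # v)) (vir_basis_bracket x y)"
proof (induction l arbitrary: u x y v rule: wf_induct_rule[OF wf_measures[of "[length, inversions]"]])
  case (1 l)
  have IH: "wh (u' @ x' # y' # v') = wh (u' @ y' # x' # v') + lin (\<lambda>b. wh (u' @ b # v')) (vir_basis_bracket x' y')"
    if "rank y' < rank x'"
      "length (u' @ x' # y' # v') < length l \<or>
       length (u' @ x' # y' # v') = length l \<and> inversions (u' @ x' # y' # v') < inversions l"
    for u' x' y' v'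
    by (rule "1.IH"[OF _ refl that(1)]) (use that(2) in auto)
  \<comment> \<open>For shorter words the relation is available at every position, not only at descents.\<close>
  have short: "wh (u' @ x' # y' # v') - wh (u' @ y' # x' # v') = lin (\<lambda>b. wh (u' @ b # v')) (vir_basis_bracket x' y')"
    if "length u' + length v' + 2 < length l" for u' x' y' v'
    by (rule exchange_from_descents, rule IH) (use that in auto)
  obtain u0 x0 y0 v0 where fd: "first_descent l = Some (u0, x0, y0, v0)"
    using "1.prems" first_descent_None[of l] by (cases "first_descent l") (auto simp: sorted_wrt_append)
  have l: "l = u0 @ x0 # y0 # v0" "rank y0 < rank x0"
    using first_descent_Some[OF fd] by auto
  have step: "wh l = wh (u0 @ y0 # x0 # v0) + lin (\<lambda>b. wh (u0 @ b # v0)) (vir_basis_bracket x0 y0)"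
    by (subst whittaker_functional.simps) (simp add: fd)
  have "length u0 \<le> length u" using first_descent_least[OF fd "1.prems"] .
  then obtain t where t: "u = u0 @ t" "x0 # y0 # v0 = t @ x # y # v"
    using "1.prems"(1) l(1) by (auto simp: append_eq_append_conv2)
  consider "t = []" | "t = [x0]" | s where "t = x0 # y0 # s"
    using t(2) by (metis append_Cons append_Nil list.sel(1) list.sel(3) neq_Nil_conv)
  then show ?case
  proof cases
    case 1
    then show ?thesis using step t l by simp
  next
    case 2
    define A where "A b c = wh (u0 @ b # c # v)" for b c
    define h where "h b = wh (u0 @ b # v)" for b
    have *: "y0 = x" "v0 = y # v" using t(2) 2 by auto
    have ord: "rank y < rank x" "rank x < rank x0" using "1.prems"(2) l(2) * by auto
    have len: "length l = length u0 + length v + 3" using l * by simp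
    \<comment> \<open>Commuting a letter past a linear combination \<open>p\<close> of letters produces the bracket with \<open>p\<close>.\<close>
    have A: "lin (\<lambda>b. A b c) p - lin (\<lambda>b. A c b) p = lin h (vir_bracket p (Poly_Mapping.single c 1))" for c p
      using short[of u0 v] len
      by (simp add: A_def h_def[abs_def] lin_vir_bracket lin_single flip: lin_fun_diff)
    have i1: "inversions (u0 @ x # x0 # y # v) < inversions l"
      using inversions_swap[OF ord(2), of u0 "y # v"] l * by simp
    have i2: "inversions (u0 @ x0 # y # x # v) < inversions l"
      using inversions_swap[OF ord(1), of "u0 @ [x0]" v] l * by simp
    have i3: "inversions (u0 @ x # y # x0 # v) < inversions l"
      using i1 inversions_swap[of y x0 "u0 @ [x]" v] ord by simp
    have i4: "inversions (u0 @ y # x0 # x # v) < inversions l"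
      using i2 inversions_swap[of y x0 u0 "x # v"] ord by simp
    \<comment> \<open>Equations 5, 1, 2 sort \<open>x\<^sub>0 x y\<close> from the left descent; equations 3, 4 sort the word \<open>x\<^sub>0 y x\<close>
      that the right descent leads to.\<close>
    have 1: "wh (u0 @ x # x0 # y # v) = wh (u0 @ x # y # x0 # v) + lin (\<lambda>b. A x b) (vir_basis_bracket x0 y)"
      using IH[of y x0 "u0 @ [x]" v] ord len i1 by (simp add: A_def)
    have 2: "wh (u0 @ x # y # x0 # v) = wh (u0 @ y # x # x0 # v) + lin (\<lambda>b. A b x0) (vir_basis_bracket x y)"
      using IH[of y x u0 "x0 # v"] ord len i3 by (simp add: A_def)
    have 3: "wh (u0 @ x0 # y # x # v) = wh (u0 @ y # x0 # x # v) + lin (\<lambda>b. A b x) (vir_basis_bracket x0 y)"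
      using IH[of y x0 u0 "x # v"] ord len i2 by (simp add: A_def)
    have 4: "wh (u0 @ y # x0 # x # v) = wh (u0 @ y # x # x0 # v) + lin (\<lambda>b. A y b) (vir_basis_bracket x0 x)"
      using IH[of x x0 "u0 @ [y]" v] ord len i4 by (simp add: A_def)
    have 5: "wh l = wh (u0 @ x # x0 # y # v) + lin (\<lambda>b. A b y) (vir_basis_bracket x0 x)"
      using step * by (simp add: A_def)
    let ?X = "Poly_Mapping.single x0 (1::complex)" and ?Y = "Poly_Mapping.single x (1::complex)"
      and ?W = "Poly_Mapping.single y (1::complex)"
    have br: "vir_basis_bracket a b = vir_bracket (Poly_Mapping.single a 1) (Poly_Mapping.single b 1)" for a b
      by (simp add: vir_bracket_single vir_scale_simps)
    have "lin h (vir_bracket (vir_bracket ?X ?Y) ?W) + lin h (vir_bracket (vir_bracket ?Y ?W) ?X)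
        - lin h (vir_bracket (vir_bracket ?X ?W) ?Y) = 0"
    proof -
      have "vir_bracket (vir_bracket ?X ?Y) ?W = - vir_bracket ?W (vir_bracket ?X ?Y)"
        "vir_bracket (vir_bracket ?Y ?W) ?X = - vir_bracket ?X (vir_bracket ?Y ?W)"
        "vir_bracket (vir_bracket ?X ?W) ?Y = vir_bracket ?Y (vir_bracket ?W ?X)"
        using vir_bracket_skew vir_bracket_scale_left[of "-1"] vir_bracket_scale_right[of _ "-1"]
        by (metis, metis, metis vir_bracket_skew vir.scale_minus_left vir.scale_one minus_minus)
      moreover have "lin h (vir_bracket ?X (vir_bracket ?Y ?W) + vir_bracket ?Y (vir_bracket ?W ?X)
          + vir_bracket ?W (vir_bracket ?X ?Y)) = 0"
        by (simp only: vir_jacobi lin_0)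
      moreover have "- c + - a - b = 0" if "a + b + c = 0" for a b c :: complex
        using that by (metis diff_minus_eq_add add.commute add.assoc minus_add_distrib neg_equal_0_iff_equal uminus_add_conv_diff)
      ultimately show ?thesis by (simp only: lin_add lin_minus)
    qed
    then have "(lin (\<lambda>b. A b y) (vir_basis_bracket x0 x) - lin (\<lambda>b. A y b) (vir_basis_bracket x0 x))
        + (lin (\<lambda>b. A b x0) (vir_basis_bracket x y) - lin (\<lambda>b. A x0 b) (vir_basis_bracket x y))
        - (lin (\<lambda>b. A b x) (vir_basis_bracket x0 y) - lin (\<lambda>b. A x b) (vir_basis_bracket x0 y)) = 0"
      by (simp only: A br)
    then have "wh l = wh (u0 @ x0 # y # x # v) + lin (\<lambda>b. A x0 b) (vir_basis_bracket x y)"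
      using 1 2 3 4 5 by (simp add: algebra_simps)
    then show ?thesis using t \<open>t = [x0]\<close> "1.prems"(1) by (simp add: A_def)
  next
    case 3
    have *: "v0 = s @ x # y # v" "u = u0 @ x0 # y0 # s" using t 3 by auto
    note ord = "1.prems"(2) l(2)
    have len: "length l = length u0 + length s + length v + 4" using l * by simp
    have i1: "inversions (u0 @ y0 # x0 # s @ x # y # v) < inversions l"
      using inversions_swap[OF ord(2), of u0 v0] l * by simp
    have i2: "inversions (u0 @ x0 # y0 # s @ y # x # v) < inversions l"
      using inversions_swap[OF ord(1), of u v] "1.prems"(1) * by simp
    have 1: "wh (u0 @ y0 # x0 # s @ x # y # v) = wh (u0 @ y0 # x0 # s @ y # x # v)
        + lin (\<lambda>c. wh (u0 @ y0 # x0 # s @ c # v)) (vir_basis_bracket x y)"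
      using IH[of y x "u0 @ y0 # x0 # s" v] ord len i1 by simp
    have 2: "wh (u0 @ b # s @ x # y # v) = wh (u0 @ b # s @ y # x # v)
        + lin (\<lambda>c. wh (u0 @ b # s @ c # v)) (vir_basis_bracket x y)" for b
      using IH[of y x "u0 @ b # s" v] ord len by simp
    have 3: "wh (u0 @ x0 # y0 # s @ y # x # v) = wh (u0 @ y0 # x0 # s @ y # x # v)
        + lin (\<lambda>b. wh (u0 @ b # s @ y # x # v)) (vir_basis_bracket x0 y0)"
      using IH[of y0 x0 u0 "s @ y # x # v"] ord len i2 by simp
    have 4: "wh (u0 @ x0 # y0 # s @ c # v) = wh (u0 @ y0 # x0 # s @ c # v)
        + lin (\<lambda>b. wh (u0 @ b # s @ c # v)) (vir_basis_bracket x0 y0)" for c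
      using IH[of y0 x0 u0 "s @ c # v"] ord len by simp
    have "wh l = wh (u0 @ x0 # y0 # s @ y # x # v)
        + lin (\<lambda>c. wh (u0 @ x0 # y0 # s @ c # v)) (vir_basis_bracket x y)"
      unfolding step *(1) 1 2 3 4 lin_fun_add
      by (simp add: lin_swap[of _ "vir_basis_bracket x0 y0"])
    then show ?thesis using * "1.prems"(1) by simp
  qed
qed

lemma whittaker_functional_exchange:
  "wh (u @ x # y # v) - wh (u @ y # x # v) = lin (\<lambda>b. wh (u @ b # v)) (vir_basis_bracket x y)"
  by (rule exchange_from_descents, rule whittaker_functional_exchange_descent[OF refl])

lemma whittaker_functional_sorted:
  "sorted_wrt (\<lambda>x y. rank x \<le> rank y) l \<Longrightarrow>
    wh l = (if \<forall>b\<in>set l. rank b > 0 then prod_list (map \<chi> l) else 0)"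
  by (subst whittaker_functional.simps) (simp flip: first_descent_None)

text \<open>Letters of positive rank act from the right by the character \<open>\<chi>\<close>. For a word that ends in \<open>j h\<close> with
  both ranks positive, exchanging the two letters costs the value of \<open>\<chi>\<close> on their bracket, which is zero.\<close>
lemma whittaker_functional_append:
  assumes char: "\<And>x y. rank x > 0 \<Longrightarrow> rank y > 0 \<Longrightarrow> lin \<chi> (vir_basis_bracket x y) = 0"
    and closed: "\<And>x y b. rank x > 0 \<Longrightarrow> rank y > 0 \<Longrightarrow> b \<in> Poly_Mapping.keys (vir_basis_bracket x y) \<Longrightarrow> rank b > 0"
  shows "rank h > 0 \<Longrightarrow> wh (l @ [h]) = \<chi> h * wh l"
proof (induction "l @ [h]" arbitrary: l h rule: wf_induct_rule[OF wf_measures[of "[length, inversions]"]])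
  case (1 l h)
  have IH: "wh (l' @ [h']) = \<chi> h' * wh l'"
    if "rank h' > 0" "length l' < length l \<or> length l' = length l \<and> inversions (l' @ [h']) < inversions (l @ [h])" for l' h'
    by (rule "1.hyps"[OF _ that(1)]) (use that(2) in auto)
  show ?case
  proof (cases "first_descent l")
    case (Some p)
    then obtain u x y v where "first_descent l = Some (u, x, y, v)" by (cases p) auto
    from first_descent_Some[OF this] have l: "l = u @ x # y # v" "rank y < rank x" by auto
    have "wh (l @ [h]) = wh ((u @ y # x # v) @ [h]) + lin (\<lambda>b. wh ((u @ b # v) @ [h])) (vir_basis_bracket x y)"
      using whittaker_functional_exchange[of u x y "v @ [h]"] by (simp add: l algebra_simps)
    also have "wh ((u @ y # x # v) @ [h]) = \<chi> h * wh (u @ y # x # v)"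
      by (rule IH[OF "1.prems"]) (use inversions_swap[OF l(2), of u "v @ [h]"] in \<open>simp add: l\<close>)
    also have "(\<lambda>b. wh ((u @ b # v) @ [h])) = (\<lambda>b. \<chi> h * wh (u @ b # v))"
      by (rule ext, rule IH[OF "1.prems"]) (simp add: l)
    finally show ?thesis
      using whittaker_functional_exchange[of u x y v] by (simp add: l lin_fun_mult algebra_simps)
  next
    case None
    then have sorted: "sorted_wrt (\<lambda>x y. rank x \<le> rank y) l" by (simp add: first_descent_None)
    show ?thesis
    proof (cases "\<forall>b\<in>set l. rank b \<le> rank h")
      case True
      then have "sorted_wrt (\<lambda>x y. rank x \<le> rank y) (l @ [h])" using sorted by (simp add: sorted_wrt_append)
      from whittaker_functional_sorted[OF this] whittaker_functional_sorted[OF sorted] "1.prems" show ?thesis by auto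
    next
      case False
      then obtain u j where l: "l = u @ [j]" by (cases l rule: rev_cases) auto
      have j: "rank h < rank j" using False sorted by (auto simp: l sorted_wrt_append) 
      then have j0: "rank j > 0" using "1.prems" by simp
      have "wh (l @ [h]) = wh ((u @ [h]) @ [j]) + lin (\<lambda>b. wh (u @ [b])) (vir_basis_bracket j h)"
        using whittaker_functional_exchange[of u j h "[]"] by (simp add: l algebra_simps)
      also have "wh ((u @ [h]) @ [j]) = \<chi> j * wh (u @ [h])"
        by (rule IH[OF j0]) (use inversions_swap[OF j, of u "[]"] in \<open>simp add: l\<close>)
      also have "wh (u @ [h]) = \<chi> h * wh u" by (rule IH[OF "1.prems"]) (simp add: l)
      also have "lin (\<lambda>b. wh (u @ [b])) (vir_basis_bracket j h) = lin (\<lambda>b. wh u * \<chi> b) (vir_basis_bracket j h)"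
        using IH closed[OF j0 "1.prems"] by (intro lin_cong refl) (simp add: l)
      also have "\<dots> = 0" using char[OF j0 "1.prems"] by (simp add: lin_fun_mult)
      also have "\<chi> j * (\<chi> h * wh u) + 0 = \<chi> h * wh l"
        using IH[OF j0, of u] by (simp add: l)
      finally show ?thesis .
    qed
  qed
qed

end

section \<open>The free algebra and the enveloping algebra\<close>

lemma poly_mapping_single_add_induct:
  assumes "P 0" "\<And>a c. P (Poly_Mapping.single a c)" "\<And>p q. P p \<Longrightarrow> P q \<Longrightarrow> P (p + q)"
  shows "P (p :: 'a \<Rightarrow>\<^sub>0 'b::comm_monoid_add)"
proof (induction p rule: update_induct)
  case (update f a b)
  have "Poly_Mapping.update a b f = f + Poly_Mapping.single a b"
    by (rule poly_mapping_eqI)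
      (use update(1) in \<open>auto simp: lookup_update lookup_add lookup_single when_def in_keys_iff\<close>)
  then show ?case using assms update by simp
qed (rule assms)

lemma lin_times: "lin h (p * q) = lin (\<lambda>a. lin (\<lambda>b. h (a + b)) q) p"
proof (induction p rule: poly_mapping_single_add_induct)
  case (2 a c)
  show ?case
    by (induction q rule: poly_mapping_single_add_induct)
      (simp_all add: lin_0 lin_add lin_single mult_single distrib_left mult.assoc)
qed (simp_all add: lin_0 lin_add distrib_right)

lemma free_algebra_fields:
  "carrier (free_algebra A) = {p. \<forall>w\<in>Poly_Mapping.keys p. set (letters w) \<subseteq> A}"
  "add (free_algebra A) = (+)" "monoid.mult (free_algebra A) = (*)"
  "ring.zero (free_algebra A) = 0" "monoid.one (free_algebra A) = 1"
  by (simp_all add: free_algebra_def ring_of_type_algebra_def)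

lemma free_algebra_closed:
  assumes "p \<in> carrier (free_algebra A)" "q \<in> carrier (free_algebra A)"
  shows "p + q \<in> carrier (free_algebra A)" "p - q \<in> carrier (free_algebra A)"
    "p * q \<in> carrier (free_algebra A)" "- p \<in> carrier (free_algebra A)"
proof -
  show "p + q \<in> carrier (free_algebra A)" "p - q \<in> carrier (free_algebra A)" "- p \<in> carrier (free_algebra A)"
    using assms keys_add[of p q] keys_diff[of p q] by (auto simp: free_algebra_fields)
  show "p * q \<in> carrier (free_algebra A)"
    using assms keys_mult[of p q] by (fastforce simp: free_algebra_fields plus_free_monoid_def)
qed

lemma free_algebra_basic:
  "0 \<in> carrier (free_algebra A)" "1 \<in> carrier (free_algebra A)" "free_scalar c \<in> carrier (free_algebra A)"
  "x \<in> A \<Longrightarrow> free_gen x \<in> carrier (free_algebra A)"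
  by (auto simp: free_algebra_fields free_scalar_def free_gen_def zero_free_monoid_def one_poly_mapping.rep_eq in_keys_iff
      lookup_single when_def lookup_one split: if_splits)

lemma ring_free_algebra: "ring (free_algebra A)"
proof (rule ringI)
  show "abelian_group (free_algebra A)"
    by (rule abelian_groupI)
      (auto simp: free_algebra_closed free_algebra_basic free_algebra_fields(2-) add_ac
        intro!: bexI[of _ "- x" for x])
  show "monoid (free_algebra A)"
    by (rule monoidI) (auto simp: free_algebra_closed free_algebra_basic free_algebra_fields(2-) mult.assoc)
qed (auto simp: free_algebra_fields(2-) distrib_left distrib_right)

lemma uea_relators_closed:
  assumes "lie_algebra G"
  shows "uea_relators G \<subseteq> carrier (free_algebra (carrier G))"
proof -
  interpret lie_algebra G by fact
  show ?thesis
    unfolding uea_relators_def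
    by (auto intro!: free_algebra_closed free_algebra_basic bracket_closed smult_closed
        simp: ring_of_type_algebra_def)
qed

lemma ideal_uea_ideal: "lie_algebra G \<Longrightarrow> ideal (uea_ideal G) (free_algebra (carrier G))"
  unfolding uea_ideal_def by (rule ring.genideal_ideal[OF ring_free_algebra uea_relators_closed])

lemma uea_ideal_closed:
  assumes "lie_algebra G"
  shows "uea_ideal G \<subseteq> carrier (free_algebra (carrier G))"
    "0 \<in> uea_ideal G" "a \<in> uea_ideal G \<Longrightarrow> b \<in> uea_ideal G \<Longrightarrow> a + b \<in> uea_ideal G"
    "a \<in> uea_ideal G \<Longrightarrow> c \<in> carrier (free_algebra (carrier G)) \<Longrightarrow> c * a \<in> uea_ideal G"
    "a \<in> uea_ideal G \<Longrightarrow> c \<in> carrier (free_algebra (carrier G)) \<Longrightarrow> a * c \<in> uea_ideal G"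
    "uea_relators G \<subseteq> uea_ideal G"
proof -
  interpret ideal "uea_ideal G" "free_algebra (carrier G)" by (rule ideal_uea_ideal[OF assms])
  show "uea_ideal G \<subseteq> carrier (free_algebra (carrier G))" by (rule a_subset)
  show "0 \<in> uea_ideal G" using additive_subgroup.zero_closed[OF is_additive_subgroup] by (simp add: free_algebra_fields)
  show "a \<in> uea_ideal G \<Longrightarrow> b \<in> uea_ideal G \<Longrightarrow> a + b \<in> uea_ideal G"
    using additive_subgroup.a_closed[OF is_additive_subgroup, of a b] by (simp add: free_algebra_fields)
  show "a \<in> uea_ideal G \<Longrightarrow> c \<in> carrier (free_algebra (carrier G)) \<Longrightarrow> c * a \<in> uea_ideal G"
    using I_l_closed[of a c] by (simp add: free_algebra_fields)
  show "a \<in> uea_ideal G \<Longrightarrow> c \<in> carrier (free_algebra (carrier G)) \<Longrightarrow> a * c \<in> uea_ideal G"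
    using I_r_closed[of a c] by (simp add: free_algebra_fields)
  show "uea_relators G \<subseteq> uea_ideal G"
    unfolding uea_ideal_def by (rule ring.genideal_self[OF ring_free_algebra uea_relators_closed[OF assms]])
qed

text \<open>The set of the elements with property \<open>Q\<close> is an ideal that contains the relators. The induction is used
  to show that maps out of the free algebra factor through the enveloping algebra.\<close>
lemma uea_ideal_induct [consumes 2, case_names relator zero diff left right]:
  assumes "lie_algebra G" and p: "p \<in> uea_ideal G"
    and rel: "\<And>a. a \<in> uea_relators G \<Longrightarrow> Q a"
    and zero: "Q 0"
    and diff: "\<And>a b. Q a \<Longrightarrow> Q b \<Longrightarrow> Q (a - b)"
    and left: "\<And>a c. c \<in> carrier (free_algebra (carrier G)) \<Longrightarrow> Q a \<Longrightarrow> Q (c * a)"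
    and right: "\<And>a c. c \<in> carrier (free_algebra (carrier G)) \<Longrightarrow> Q a \<Longrightarrow> Q (a * c)"
  shows "Q p"
proof -
  let ?R = "free_algebra (carrier G)" and ?I = "{a \<in> carrier (free_algebra (carrier G)). Q a}"
  interpret R: ring ?R by (rule ring_free_algebra)
  have neg: "Q (- a)" if "Q a" for a using diff[OF zero that] by simp
  have add: "Q (a + b)" if "Q a" "Q b" for a b using diff[OF that(1) neg[OF that(2)]] by simp
  have minus: "\<ominus>\<^bsub>?R\<^esub> a = - a" if "a \<in> carrier ?R" for a
    by (rule R.minus_equality) (use that in \<open>auto simp: free_algebra_fields(2-) free_algebra_closed\<close>)
  have "ideal ?I ?R"
  proof (rule idealI[OF ring_free_algebra])
    show "subgroup ?I (add_monoid ?R)"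
      by (rule R.add.subgroupI)
        (auto simp: minus neg add zero free_algebra_closed free_algebra_basic free_algebra_fields(2-)
          intro!: exI[of _ 0] simp flip: a_inv_def)
  qed (auto simp: left right free_algebra_closed free_algebra_fields(2-))
  moreover have "uea_relators G \<subseteq> ?I" using rel uea_relators_closed[OF assms(1)] by auto
  ultimately have "uea_ideal G \<subseteq> ?I" unfolding uea_ideal_def by (rule R.genideal_minimal)
  then show ?thesis using p by auto
qed

section \<open>An action on functions of words\<close>
text \<open>A function of words is a functional on the tensor algebra, and right multiplication on the
  tensor algebra gives a left action on such functionals.\<close>
definition vir_act :: "vir \<Rightarrow> (vir_basis list \<Rightarrow> complex) \<Rightarrow> vir_basis list \<Rightarrow> complex"
  where "vir_act x g u = lin (\<lambda>b. g (u @ [b])) x"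

text \<open>The functionals that vanish on the ideal of the commutation relations: the dual space of \<open>U(V)\<close>. The
  suffix \<open>v\<close> is what makes the set stable under \<open>vir_act\<close>.\<close>
definition uea_dual :: "(vir_basis list \<Rightarrow> complex) set"
  where "uea_dual = {g. \<forall>u x y v. g (u @ x # y # v) - g (u @ y # x # v) = lin (\<lambda>b. g (u @ b # v)) (vir_basis_bracket x y)}"

lemma vir_act_uea_dual:
  assumes "g \<in> uea_dual"
  shows "vir_act x g \<in> uea_dual"
proof -
  have "vir_act x g (u @ a # b # v) - vir_act x g (u @ b # a # v)
      = lin (\<lambda>c. vir_act x g (u @ c # v)) (vir_basis_bracket a b)" for u a b v
  proof -
    have "vir_act x g (u @ a # b # v) - vir_act x g (u @ b # a # v)
        = lin (\<lambda>c. g (u @ a # b # v @ [c]) - g (u @ b # a # v @ [c])) x"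
      by (simp add: vir_act_def lin_fun_diff)
    also have "\<dots> = lin (\<lambda>c. lin (\<lambda>e. g (u @ e # v @ [c])) (vir_basis_bracket a b)) x"
      using assms by (simp add: uea_dual_def)
    finally show ?thesis by (simp add: vir_act_def lin_swap[of _ "vir_basis_bracket a b"])
  qed
  then show ?thesis by (simp add: uea_dual_def)
qed

lemma vir_act_bracket:
  assumes "g \<in> uea_dual"
  shows "vir_act x (vir_act y g) u - vir_act y (vir_act x g) u = vir_act (vir_bracket x y) g u"
proof -
  have "vir_act x (vir_act y g) u - vir_act y (vir_act x g) u
      = lin (\<lambda>a. lin (\<lambda>b. g (u @ a # b # []) - g (u @ b # a # [])) y) x"
    by (simp add: vir_act_def lin_fun_diff lin_swap[of _ x y])
  also have "\<dots> = lin (\<lambda>a. lin (\<lambda>b. lin (\<lambda>e. g (u @ [e])) (vir_basis_bracket a b)) y) x"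
    using assms by (simp only: uea_dual_def mem_Collect_eq)
  finally show ?thesis by (simp add: vir_act_def lin_vir_bracket)
qed

definition rep :: "(vir free_monoid \<Rightarrow>\<^sub>0 complex) \<Rightarrow> (vir_basis list \<Rightarrow> complex) \<Rightarrow> vir_basis list \<Rightarrow> complex"
  where "rep p g u = lin (\<lambda>w. foldr vir_act (letters w) g u) p"

lemma foldr_vir_act_uea_dual: "g \<in> uea_dual \<Longrightarrow> foldr vir_act l g \<in> uea_dual"
  by (induction l) (auto intro: vir_act_uea_dual)

lemma rep_uea_dual:
  assumes "g \<in> uea_dual"
  shows "rep p g \<in> uea_dual"
proof -
  have "foldr vir_act l g (u @ x # y # v) - foldr vir_act l g (u @ y # x # v)
    = lin (\<lambda>b. foldr vir_act l g (u @ b # v)) (vir_basis_bracket x y)" for l u x y v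
    using foldr_vir_act_uea_dual[OF assms, of l] by (simp add: uea_dual_def)
  then show ?thesis
    by (simp add: uea_dual_def rep_def lin_swap[of _ "vir_basis_bracket x y" for x y] flip: lin_fun_diff)
qed

lemma foldr_vir_act_lin:
  "foldr vir_act l (\<lambda>u. lin (\<lambda>w. g w u) p) u = lin (\<lambda>w. foldr vir_act l (g w) u) p"
proof (induction l arbitrary: u)
  case (Cons x l)
  then show ?case by (simp add: vir_act_def lin_swap[of _ x p])
qed simp

lemma rep_times: "rep (p * q) g = rep p (rep q g)"
proof
  fix u
  have "rep q g = (\<lambda>u. lin (\<lambda>w. foldr vir_act (letters w) g u) q)" by (simp add: rep_def fun_eq_iff)
  then show "rep (p * q) g u = rep p (rep q g) u"
    by (simp only: rep_def[of p] rep_def[of "p * q"] lin_times foldr_vir_act_lin) (simp add: plus_free_monoid_def)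
qed

lemma rep_simps:
  "rep (p + q) g u = rep p g u + rep q g u"
  "rep (p - q) g u = rep p g u - rep q g u"
  "rep 0 g u = 0"
  "rep (free_gen x) g = vir_act x g"
  "rep (free_scalar c) g u = c * g u"
  by (simp_all add: rep_def lin_add lin_diff lin_0 fun_eq_iff free_gen_def free_scalar_def lin_single zero_free_monoid_def)

lemma rep_1: "rep 1 g = g"
  using rep_simps(5)[of 1 g] by (simp add: fun_eq_iff free_scalar_def)

lemma rep_zero_fun: "rep p (\<lambda>u. 0) = (\<lambda>u. 0)"
proof -
  have "foldr vir_act l (\<lambda>u. 0) = (\<lambda>u. 0)" for l
    by (induction l) (simp_all add: vir_act_def fun_eq_iff lin_fun_0)
  then show ?thesis by (simp add: rep_def fun_eq_iff lin_fun_0)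
qed

lemma rep_uea_ideal:
  assumes "p \<in> uea_ideal virasoro" "g \<in> uea_dual"
  shows "rep p g = (\<lambda>u. 0)"
proof -
  have "\<forall>g\<in>uea_dual. rep p g = (\<lambda>u. 0)"
    using lie_algebra_virasoro assms(1)
  proof (induction rule: uea_ideal_induct)
    case (relator a)
    show ?case
    proof
      fix g :: "vir_basis list \<Rightarrow> complex" assume g: "g \<in> uea_dual"
      show "rep a g = (\<lambda>u. 0)"
        using relator vir_act_bracket[OF g]
        by (auto simp: uea_relators_def vir_fields rep_simps rep_times fun_eq_iff vir_act_def lin_add lin_vir_scale)
    qed
  next
    case (left a c)
    then show ?case by (simp add: rep_times rep_zero_fun)
  next
    case (right a c)
    then show ?case by (simp add: rep_times rep_uea_dual)
  qed (simp_all add: rep_simps fun_eq_iff)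
  then show ?thesis using assms(2) by auto
qed

text \<open>The action of the free algebra on the line on which each vector acts by its value under \<open>\<psi>\<close>.\<close>
definition char_eval :: "(vir \<Rightarrow> complex) \<Rightarrow> (vir free_monoid \<Rightarrow>\<^sub>0 complex) \<Rightarrow> complex"
  where "char_eval \<psi> p = lin (\<lambda>w. prod_list (map \<psi> (letters w))) p"

lemma char_eval_simps:
  "char_eval \<psi> (p + q) = char_eval \<psi> p + char_eval \<psi> q"
  "char_eval \<psi> (p - q) = char_eval \<psi> p - char_eval \<psi> q"
  "char_eval \<psi> 0 = 0"
  "char_eval \<psi> (p * q) = char_eval \<psi> p * char_eval \<psi> q"
  "char_eval \<psi> (free_gen x) = \<psi> x"
  "char_eval \<psi> (free_scalar c) = c"
proof -
  have "lin (\<lambda>a. h a * c) p = lin h p * c" for h :: "vir free_monoid \<Rightarrow> complex" and c p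
    using lin_fun_mult[of c h p] by (simp add: mult.commute)
  then show "char_eval \<psi> (p * q) = char_eval \<psi> p * char_eval \<psi> q"
    by (simp add: char_eval_def lin_times plus_free_monoid_def lin_fun_mult)
qed (simp_all add: char_eval_def lin_add lin_diff lin_0 free_gen_def free_scalar_def lin_single zero_free_monoid_def)

lemma n_plus_fields:
  "add n_plus = (+)" "ring.zero n_plus = 0" "module.smult n_plus = vir_scale" "lie_bracket n_plus = vir_bracket"
  using vir_fields by (simp_all add: n_plus_def)

lemma vir_d_n_plus: "k \<ge> 1 \<Longrightarrow> vir_d k \<in> carrier n_plus"
  by (auto simp: n_plus_keys vir_d_def)

locale whittaker_type =
  fixes \<psi> :: "vir \<Rightarrow> complex"
  assumes hom: "lie_hom n_plus complex_lie \<psi>"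
begin

lemma psi_add: "x \<in> carrier n_plus \<Longrightarrow> y \<in> carrier n_plus \<Longrightarrow> \<psi> (x + y) = \<psi> x + \<psi> y"
  and psi_scale: "x \<in> carrier n_plus \<Longrightarrow> \<psi> (vir_scale c x) = c * \<psi> x"
  and psi_bracket: "x \<in> carrier n_plus \<Longrightarrow> y \<in> carrier n_plus \<Longrightarrow> \<psi> (vir_bracket x y) = 0"
  using hom by (simp_all add: lie_hom_def n_plus_def virasoro_def complex_lie_def complex_line_def mk_module_def
      module.defs lie_alg.defs)

lemma char_eval_uea_ideal:
  assumes "p \<in> uea_ideal n_plus"
  shows "char_eval \<psi> p = 0"
  using lie_algebra_n_plus assms
proof (induction rule: uea_ideal_induct)
  case (relator a)
  then show ?case
    by (auto simp: uea_relators_def n_plus_fields char_eval_simps psi_add psi_scale psi_bracket)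
qed (auto simp: char_eval_simps)

text \<open>\<open>d\<^sub>k\<close> is a multiple of the commutator of \<open>d\<^sub>1\<close> and \<open>d_{k-1}\<close>; for \<open>k = 2\<close> that commutator vanishes.\<close>
lemma psi_d_ge_3: "k \<ge> 3 \<Longrightarrow> \<psi> (vir_d k) = 0"
proof -
  assume k: "k \<ge> 3"
  have "vir_bracket (vir_d 1) (vir_d (k - 1)) = vir_scale (of_int (k - 2)) (vir_d k)"
    using k by (simp add: vir_bracket_basis)
  then have "of_int (k - 2) * \<psi> (vir_d k) = 0"
    using psi_bracket[of "vir_d 1" "vir_d (k - 1)"] psi_scale[of "vir_d k" "of_int (k - 2)"] k
    by (simp add: vir_d_n_plus)
  moreover have "complex_of_int (k - 2) \<noteq> 0" using k by (simp only: of_int_eq_0_iff)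
  ultimately show ?thesis by simp
qed

fun basis_char :: "complex \<Rightarrow> vir_basis \<Rightarrow> complex"
  where
    "basis_char \<xi> (D k) = \<psi> (vir_d k)"
  | "basis_char \<xi> Z = \<xi>"

lemma lin_basis_char: "x \<in> carrier n_plus \<Longrightarrow> lin (basis_char \<xi>) x = \<psi> x"
proof -
  have "\<psi> 0 = 0" using psi_scale[of 0 0] by (simp add: vir_scale_simps n_plus_keys)
  assume "x \<in> carrier n_plus"
  then have "x \<in> vir.span {vir_d k |k. k \<ge> 1}" by (simp add: n_plus_def)
  then have "x \<in> carrier n_plus \<and> lin (basis_char \<xi>) x = \<psi> x"
  proof (induction rule: vir.span_induct_alt)
    case base
    then show ?case using \<open>\<psi> 0 = 0\<close> by (simp add: lin_0 n_plus_keys)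
  next
    case (step c x y)
    then obtain k where k: "x = vir_d k" "k \<ge> 1" by auto
    have "vir_scale c x \<in> carrier n_plus" "vir_scale c x + y \<in> carrier n_plus"
      using step k vir_d_n_plus[OF k(2)] unfolding n_plus_def by (auto intro: vir.span_add vir.span_scale)
    then show ?case
      using step k vir_d_n_plus[OF k(2)]
      by (simp add: lin_add lin_vir_scale psi_add psi_scale vir_d_def lin_single)
  qed
  then show ?thesis ..
qed

lemma whittaker_functional_exists:
  obtains f where "f [] = 1" "f \<in> uea_dual" "\<And>x u. x \<in> carrier n_plus \<Longrightarrow> vir_act x f u = \<psi> x * f u"
    "\<And>u. vir_act vir_z f u = \<xi> * f u"
proof
  let ?f = "whittaker_functional (basis_char \<xi>)"
  have br: "lin (basis_char \<xi>) (vir_basis_bracket x y) = 0 \<and>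
      (\<forall>b\<in>Poly_Mapping.keys (vir_basis_bracket x y). rank b > 0)" if "rank x > 0" "rank y > 0" for x y
  proof (cases x; cases y)
    fix k j assume "x = D k" "y = D j"
    then have eq: "vir_basis_bracket x y = vir_bracket (vir_d k) (vir_d j)" "k \<ge> 1" "j \<ge> 1"
      using that by (simp_all add: vir_bracket_basis)
    then have "vir_basis_bracket x y \<in> carrier n_plus"
      using vir_bracket_n_plus[of "vir_d k" "vir_d j"] by (simp add: vir_d_n_plus)
    then show ?thesis
      using lin_basis_char[of "vir_basis_bracket x y" \<xi>] psi_bracket[OF vir_d_n_plus vir_d_n_plus, of k j] eq
      by (auto simp: n_plus_keys)
  qed (simp_all add: lin_0)
  have char: "?f (l @ [h]) = basis_char \<xi> h * ?f l" if "rank h > 0" for l h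
    by (rule whittaker_functional_append[OF conjunct1[OF br] bspec[OF conjunct2[OF br]] that])
  show "?f [] = 1" by (subst whittaker_functional.simps) simp
  show "?f \<in> uea_dual" by (simp add: uea_dual_def whittaker_functional_exchange)
  show "vir_act vir_z ?f u = \<xi> * ?f u" for u
    by (simp add: vir_act_def vir_z_def lin_single char)
  show "vir_act x ?f u = \<psi> x * ?f u" if x: "x \<in> carrier n_plus" for x u
  proof -
    have "vir_act x ?f u = lin (\<lambda>b. ?f u * basis_char \<xi> b) x"
      unfolding vir_act_def using x by (intro lin_cong refl) (auto simp: n_plus_keys char)
    then show ?thesis using lin_basis_char[OF x] by (simp add: lin_fun_mult)
  qed
qed

end

section \<open>Quotient modules and the enveloping algebra as a quotient\<close>

lemma mk_module_fields:
  "carrier (mk_module C ad z sm) = C" "add (mk_module C ad z sm) = ad"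
  "ring.zero (mk_module C ad z sm) = z" "module.smult (mk_module C ad z sm) = sm"
  by (simp_all add: mk_module_def)

text \<open>The rings in question are not commutative. Each scalar in \<open>R\<close> is treated separately, as an additive
  map of \<open>M\<close> that preserves \<open>N\<close>; this is what the definition of \<open>quot_module\<close> relies on.\<close>
locale quotient_module = abelian_subgroup N M
  for N :: "'m set" and M :: "('r, 'm, 'b) module_scheme" (structure) +
  fixes R :: "'r set"
  assumes smult_closed: "r \<in> R \<Longrightarrow> m \<in> carrier M \<Longrightarrow> r \<odot> m \<in> carrier M"
    and smult_add: "r \<in> R \<Longrightarrow> m \<in> carrier M \<Longrightarrow> m' \<in> carrier M \<Longrightarrow> r \<odot> (m \<oplus> m') = r \<odot> m \<oplus> r \<odot> m'"
    and smult_sub: "r \<in> R \<Longrightarrow> m \<in> N \<Longrightarrow> r \<odot> m \<in> N"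
begin

lemma quot_carrier: "carrier (quot_module M N) = (\<lambda>m. N +> m) ` carrier M"
  by (auto simp: quot_module_def mk_module_fields A_RCOSETS_def')

lemma quot_zero: "\<zero>\<^bsub>quot_module M N\<^esub> = N"
  by (simp add: quot_module_def mk_module_fields)

lemma quot_add:
  "m \<in> carrier M \<Longrightarrow> m' \<in> carrier M \<Longrightarrow> (N +> m) \<oplus>\<^bsub>quot_module M N\<^esub> (N +> m') = N +> (m \<oplus> m')"
  by (simp add: quot_module_def mk_module_fields a_rcos_sum)

lemma quot_eq:
  assumes "m \<in> carrier M" "m' \<in> carrier M"
  shows "N +> m = N +> m' \<longleftrightarrow> m \<ominus> m' \<in> N"
  using a_rcos_module[OF assms(2,1)] a_repr_independence'[of m m'] a_rcos_self[of m] assms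
  by (auto simp: a_minus_def)

lemma quot_eq_zero: "m \<in> carrier M \<Longrightarrow> N +> m = N \<longleftrightarrow> m \<in> N"
  using a_rcos_const a_rcos_self by auto

lemma quot_smult:
  assumes r: "r \<in> R" and m: "m \<in> carrier M"
  shows "r \<odot>\<^bsub>quot_module M N\<^esub> (N +> m) = N +> (r \<odot> m)"
proof -
  have "N +> (r \<odot> y) = N +> (r \<odot> m)" if y: "y \<in> N +> m" for y
  proof -
    from y obtain n where n: "n \<in> N" "y = n \<oplus> m" by (auto simp: a_r_coset_def')
    have "n \<in> carrier M" using n by simp
    then have "r \<odot> y = r \<odot> n \<oplus> r \<odot> m" "r \<odot> m \<in> carrier M" "r \<odot> n \<in> N"
      using n smult_add[OF r] smult_closed[OF r] smult_sub[OF r] m by auto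
    then have "r \<odot> y \<in> N +> (r \<odot> m)" by (auto simp: a_r_coset_def')
    then show ?thesis using a_repr_independence' \<open>r \<odot> m \<in> carrier M\<close> by metis
  qed
  moreover have "m \<in> N +> m" using a_rcos_self m by simp
  ultimately have "(\<Union>y\<in>N +> m. N +> (r \<odot> y)) = N +> (r \<odot> m)" by (intro UN_constant_eq[of m]) blast+
  then show ?thesis by (simp add: quot_module_def mk_module_fields)
qed

lemma quot_abelian_group: "abelian_group (quot_module M N)"
proof (rule abelian_groupI)
  let ?Q = "quot_module M N"
  have zero: "\<zero>\<^bsub>?Q\<^esub> = N +> \<zero>" using quot_eq_zero[of \<zero>] by (simp add: quot_zero)
  show "\<zero>\<^bsub>?Q\<^esub> \<in> carrier ?Q" by (auto simp: zero quot_carrier)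
  show "x \<oplus>\<^bsub>?Q\<^esub> y \<in> carrier ?Q" if "x \<in> carrier ?Q" "y \<in> carrier ?Q" for x y
    using that by (auto simp: quot_carrier quot_add)
  show "x \<oplus>\<^bsub>?Q\<^esub> y \<oplus>\<^bsub>?Q\<^esub> z = x \<oplus>\<^bsub>?Q\<^esub> (y \<oplus>\<^bsub>?Q\<^esub> z)" if "x \<in> carrier ?Q" "y \<in> carrier ?Q" "z \<in> carrier ?Q" for x y z
    using that by (auto simp: quot_carrier quot_add a_assoc)
  show "x \<oplus>\<^bsub>?Q\<^esub> y = y \<oplus>\<^bsub>?Q\<^esub> x" if "x \<in> carrier ?Q" "y \<in> carrier ?Q" for x y
    using that by (auto simp: quot_carrier quot_add a_comm)
  show "\<zero>\<^bsub>?Q\<^esub> \<oplus>\<^bsub>?Q\<^esub> x = x" if "x \<in> carrier ?Q" for x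
    using that by (auto simp: quot_carrier quot_add zero)
  show "\<exists>y\<in>carrier ?Q. y \<oplus>\<^bsub>?Q\<^esub> x = \<zero>\<^bsub>?Q\<^esub>" if x: "x \<in> carrier ?Q" for x
  proof -
    obtain m where "m \<in> carrier M" "x = N +> m" using x by (auto simp: quot_carrier)
    then show ?thesis by (intro bexI[of _ "N +> (\<ominus> m)"]) (auto simp: quot_carrier quot_add zero l_neg)
  qed
qed

end

lemma free_scalar_simps:
  "free_scalar (a + b) = free_scalar a + free_scalar b" "free_scalar (a * b) = free_scalar a * free_scalar b"
  "free_scalar 0 = 0" "free_scalar 1 = 1"
  by (simp_all add: free_scalar_def single_add mult_single)

lemma free_algebra_induct [case_names scalar gen add]:
  assumes "\<And>c. P (free_scalar c)" "\<And>x p. P p \<Longrightarrow> P (free_gen x * p)" "\<And>p q. P p \<Longrightarrow> P q \<Longrightarrow> P (p + q)"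
  shows "P p"
proof (induction p rule: poly_mapping_single_add_induct)
  case (2 a c)
  obtain l where a: "a = Word l" by (cases a)
  have "P (Poly_Mapping.single (Word l) c)"
  proof (induction l)
    case Nil
    then show ?case using assms(1)[of c] by (simp add: free_scalar_def zero_free_monoid_def)
  next
    case (Cons x l)
    have "free_gen x * Poly_Mapping.single (Word l) c = Poly_Mapping.single (Word (x # l)) c"
      by (simp add: free_gen_def mult_single plus_free_monoid_def)
    then show ?case using assms(2)[OF Cons, of x] by simp
  qed
  then show ?case by (simp add: a)
qed (use assms(1)[of 0] assms(3) in \<open>auto simp: free_scalar_simps\<close>)

lemma free_scalar_commute: "free_scalar c * p = p * free_scalar c"
proof (induction p rule: free_algebra_induct)
  case (scalar a)
  then show ?case by (simp add: mult.commute flip: free_scalar_simps)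
next
  case (gen x p)
  have "free_scalar c * free_gen x = free_gen x * free_scalar c"
    by (simp add: free_scalar_def free_gen_def mult_single)
  then show ?case using gen by (metis mult.assoc)
qed (simp add: distrib_left distrib_right)

lemma free_algebra_UNIV: "carrier (free_algebra (carrier virasoro)) = UNIV"
  by (simp add: free_algebra_fields vir_fields)

abbreviation U :: "vir_uea ring"
  where "U \<equiv> uea virasoro"

abbreviation cl :: "(vir free_monoid \<Rightarrow>\<^sub>0 complex) \<Rightarrow> vir_uea"
  where "cl \<equiv> uea_class virasoro"

lemma uea_ideal_vir:
  "0 \<in> uea_ideal virasoro"
  "a \<in> uea_ideal virasoro \<Longrightarrow> b \<in> uea_ideal virasoro \<Longrightarrow> a + b \<in> uea_ideal virasoro"
  "a \<in> uea_ideal virasoro \<Longrightarrow> - a \<in> uea_ideal virasoro"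
  "a \<in> uea_ideal virasoro \<Longrightarrow> b \<in> uea_ideal virasoro \<Longrightarrow> a - b \<in> uea_ideal virasoro"
  "a \<in> uea_ideal virasoro \<Longrightarrow> c * a \<in> uea_ideal virasoro"
  "a \<in> uea_ideal virasoro \<Longrightarrow> a * c \<in> uea_ideal virasoro"
proof -
  note I = uea_ideal_closed[OF lie_algebra_virasoro, unfolded free_algebra_UNIV]
  show "0 \<in> uea_ideal virasoro"
    "a \<in> uea_ideal virasoro \<Longrightarrow> b \<in> uea_ideal virasoro \<Longrightarrow> a + b \<in> uea_ideal virasoro"
    "a \<in> uea_ideal virasoro \<Longrightarrow> c * a \<in> uea_ideal virasoro"
    "a \<in> uea_ideal virasoro \<Longrightarrow> a * c \<in> uea_ideal virasoro"
    by (simp_all add: I)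
  show neg: "- a \<in> uea_ideal virasoro" if "a \<in> uea_ideal virasoro" for a
    using I(4)[of a "- 1"] that by simp
  show "a \<in> uea_ideal virasoro \<Longrightarrow> b \<in> uea_ideal virasoro \<Longrightarrow> a - b \<in> uea_ideal virasoro"
    using I(3)[of a "- b"] neg[of b] by simp
qed

lemma uea_relations:
  "free_gen (x + y) - (free_gen x + free_gen y) \<in> uea_ideal virasoro"
  "free_gen (vir_scale c x) - free_scalar c * free_gen x \<in> uea_ideal virasoro"
  "free_gen x * free_gen y - free_gen y * free_gen x - free_gen (vir_bracket x y) \<in> uea_ideal virasoro"
proof -
  have I: "a \<in> uea_relators virasoro \<Longrightarrow> a \<in> uea_ideal virasoro" for a
    using uea_ideal_closed(6)[OF lie_algebra_virasoro] by blast
  show "free_gen (x + y) - (free_gen x + free_gen y) \<in> uea_ideal virasoro"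
    by (rule I) (auto simp: uea_relators_def vir_fields)
  show "free_gen (vir_scale c x) - free_scalar c * free_gen x \<in> uea_ideal virasoro"
    by (rule I) (auto simp: uea_relators_def vir_fields)
  show "free_gen x * free_gen y - free_gen y * free_gen x - free_gen (vir_bracket x y) \<in> uea_ideal virasoro"
    by (rule I) (auto simp: uea_relators_def vir_fields)
qed

lemma uea_class_eq:
  assumes "lie_algebra G"
  shows "uea_class G p = {i + p |i. i \<in> uea_ideal G}"
  by (auto simp: uea_class_def a_r_coset_def' free_algebra_fields)

lemma cl_eq: "cl p = cl q \<longleftrightarrow> p - q \<in> uea_ideal virasoro"
proof
  assume "cl p = cl q"
  moreover have "0 + p \<in> cl p" using uea_ideal_vir(1) unfolding uea_class_eq[OF lie_algebra_virasoro] by blast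
  ultimately obtain i where "i \<in> uea_ideal virasoro" "p = i + q"
    unfolding uea_class_eq[OF lie_algebra_virasoro] by auto
  then show "p - q \<in> uea_ideal virasoro" by simp
next
  assume pq: "p - q \<in> uea_ideal virasoro"
  have "i + p = (i + (p - q)) + q" "i + q = (i - (p - q)) + p" for i by simp_all
  then show "cl p = cl q"
    unfolding uea_class_eq[OF lie_algebra_virasoro] using uea_ideal_vir(2,4) pq by blast
qed

lemma cl_U:
  "carrier U = range cl" "cl p \<oplus>\<^bsub>U\<^esub> cl q = cl (p + q)" "cl p \<otimes>\<^bsub>U\<^esub> cl q = cl (p * q)"
  "cl p \<ominus>\<^bsub>U\<^esub> cl q = cl (p - q)" "ring U"
proof -
  interpret I: ideal "uea_ideal virasoro" "free_algebra (carrier virasoro)"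
    by (rule ideal_uea_ideal[OF lie_algebra_virasoro])
  show carr: "carrier U = range cl"
    by (auto simp: uea_def FactRing_def A_RCOSETS_def' uea_class_def free_algebra_UNIV)
  show add: "cl p \<oplus>\<^bsub>U\<^esub> cl q = cl (p + q)" for p q
    using I.a_rcos_sum[of p q] by (simp add: uea_def FactRing_def uea_class_def free_algebra_UNIV free_algebra_fields(2))
  show "cl p \<otimes>\<^bsub>U\<^esub> cl q = cl (p * q)"
    using I.rcoset_mult_add[of p q] by (simp add: uea_def FactRing_def uea_class_def free_algebra_UNIV free_algebra_fields(3))
  show "ring U" unfolding uea_def by (rule I.quotient_is_ring)
  then interpret U: ring U .
  have "\<zero>\<^bsub>U\<^esub> = cl 0"
    using I.a_rcos_const[of 0] uea_ideal_vir(1) by (simp add: uea_def FactRing_def uea_class_def)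
  then have "\<ominus>\<^bsub>U\<^esub> cl q = cl (- q)" by (intro U.minus_equality) (simp_all add: add carr)
  then show "cl p \<ominus>\<^bsub>U\<^esub> cl q = cl (p - q)" by (simp add: a_minus_def add)
qed

text \<open>By induction on \<open>p\<close>: the letter \<open>z\<close> commutes with every letter, up to \<open>free_gen 0\<close>, which is in the ideal
  because of the relator for the scalar multiple by 0.\<close>
lemma vir_z_central: "free_gen vir_z * p - p * free_gen vir_z \<in> uea_ideal virasoro"
proof (induction p rule: free_algebra_induct)
  case (scalar c)
  then show ?case by (simp add: free_scalar_commute uea_ideal_vir)
next
  case (gen x p)
  let ?z = "free_gen vir_z"
  have "free_gen 0 \<in> uea_ideal virasoro"
    using uea_relations(2)[of 0 0] by (simp add: vir_scale_simps free_scalar_simps)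
  with uea_relations(3)[of vir_z x] have "?z * free_gen x - free_gen x * ?z \<in> uea_ideal virasoro"
    using uea_ideal_vir(2) by (fastforce simp: vir_bracket_basis)
  then have "(?z * free_gen x - free_gen x * ?z) * p + free_gen x * (?z * p - p * ?z) \<in> uea_ideal virasoro"
    using gen by (intro uea_ideal_vir(2,5,6))
  then show ?case by (simp add: algebra_simps)
next
  case (add p q)
  then show ?case using uea_ideal_vir(2)[OF add] by (simp add: algebra_simps)
qed

lemma uea_ideal_n_plus_subset: "p \<in> uea_ideal n_plus \<Longrightarrow> p \<in> uea_ideal virasoro"
  using lie_algebra_n_plus
proof (induction rule: uea_ideal_induct)
  case (relator a)
  then show ?case
    by (auto simp: uea_relators_def n_plus_fields uea_relations)
qed (simp_all add: uea_ideal_vir)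

lemma uea_inclusion_class: "uea_inclusion virasoro (uea_class n_plus p) = cl p"
proof -
  have "cl q = cl p" if "q \<in> uea_class n_plus p" for q
    using that by (auto simp: uea_class_eq[OF lie_algebra_n_plus] cl_eq intro: uea_ideal_n_plus_subset)
  moreover have "0 + p \<in> uea_class n_plus p"
    using uea_ideal_closed(2)[OF lie_algebra_n_plus] unfolding uea_class_eq[OF lie_algebra_n_plus] by blast
  ultimately have "(\<Union>q\<in>uea_class n_plus p. cl q) = cl p" by (intro UN_constant_eq[of "0 + p"]) blast+
  then show ?thesis by (simp add: uea_inclusion_def)
qed

lemma carrier_uea_n_plus: "carrier (uea n_plus) = uea_class n_plus ` carrier (free_algebra (carrier n_plus))"
  by (auto simp: uea_def FactRing_def A_RCOSETS_def' uea_class_def)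

lemma complex_line_fields:
  "carrier complex_line = UNIV" "add complex_line = (+)" "ring.zero complex_line = 0" "module.smult complex_line = (*)"
  by (simp_all add: complex_line_def mk_module_def)

text \<open>The line \<open>complex_line\<close> carries a multiplicative action, so a word acts by the product of the values
  of its letters.\<close>
lemma free_algebra_act_complex_line: "free_algebra_act complex_line (\<lambda>x c. \<psi> x * c) p v = char_eval \<psi> p * v"
proof -
  interpret L: abelian_group complex_line
    by (rule abelian_groupI) (auto simp: complex_line_fields intro: exI[of _ "- x" for x])
  have fold: "foldr (\<lambda>x c. \<psi> x * c) l v = prod_list (map \<psi> l) * v" for l
    by (induction l) simp_all
  have "finsum complex_line h A = sum h A" if "finite A" for h and A :: "vir free_monoid set"
    using that by (induction A) (simp_all add: complex_line_fields)
  then show ?thesis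
    by (simp add: free_algebra_act_def char_eval_def lin_def complex_line_fields fold sum_distrib_right mult.assoc)
qed

lemma whittaker_line_fields:
  "carrier (whittaker_line \<psi>) = UNIV" "add (whittaker_line \<psi>) = (+)"
  by (simp_all add: whittaker_line_def uea_module_def mk_module_fields complex_line_fields)

text \<open>The homomorphism from a free abelian group that extends \<open>h\<close>.\<close>
definition frag_sum :: "('a \<Rightarrow> complex) \<Rightarrow> ('a \<Rightarrow>\<^sub>0 int) \<Rightarrow> complex"
  where "frag_sum h x = (\<Sum>k\<in>Poly_Mapping.keys x. of_int (Poly_Mapping.lookup x k) * h k)"

lemma frag_sum_add: "frag_sum h (x + y) = frag_sum h x + frag_sum h y"
proof -
  have super: "frag_sum h z = (\<Sum>k\<in>Poly_Mapping.keys x \<union> Poly_Mapping.keys y. of_int (Poly_Mapping.lookup z k) * h k)"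
    if "Poly_Mapping.keys z \<subseteq> Poly_Mapping.keys x \<union> Poly_Mapping.keys y" for z
    unfolding frag_sum_def by (rule sum.mono_neutral_left) (use that in \<open>auto simp: in_keys_iff\<close>)
  show ?thesis using super[of x] super[of y] super[OF keys_add]
    by (simp add: lookup_add distrib_right sum.distrib)
qed

lemma frag_sum_simps:
  "frag_sum h 0 = 0" "frag_sum h (frag_of k) = h k" "frag_sum h (x - y) = frag_sum h x - frag_sum h y"
  using frag_sum_add[of h "x - y" y] by (simp_all add: frag_sum_def)

section \<open>The universal Whittaker module\<close>

context whittaker_type
begin

lemma whittaker_line_smult: "uea_class n_plus p \<odot>\<^bsub>whittaker_line \<psi>\<^esub> v = char_eval \<psi> p * v"
proof -
  have "(\<lambda>p. char_eval \<psi> p * v) ` uea_class n_plus p = {char_eval \<psi> p * v}"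
    using uea_ideal_closed(2)[OF lie_algebra_n_plus]
    by (force simp: uea_class_eq[OF lie_algebra_n_plus] char_eval_simps char_eval_uea_ideal)
  then show ?thesis
    by (simp add: whittaker_line_def uea_module_def mk_module_fields free_algebra_act_complex_line)
qed

text \<open>\<open>M\<close> is the quotient of the free abelian group \<open>T\<close> by the subgroup \<open>tensor_sub\<close> that the tensor
  relations generate.\<close>
abbreviation T :: "(vir_uea, (vir_uea \<times> complex) \<Rightarrow>\<^sub>0 int) module"
  where "T \<equiv> tensor_free U (whittaker_line \<psi>)"

abbreviation relators :: "((vir_uea \<times> complex) \<Rightarrow>\<^sub>0 int) set"
  where "relators \<equiv> tensor_relators (uea_inclusion virasoro) (uea n_plus) U (whittaker_line \<psi>)"

abbreviation M where "M \<equiv> universal_whittaker \<psi>"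

definition tensor_sub :: "((vir_uea \<times> complex) \<Rightarrow>\<^sub>0 int) set"
  where "tensor_sub = generate (free_Abelian_group (carrier U \<times> carrier (whittaker_line \<psi>)))
    relators"

lemma M_eq: "M = quot_module T tensor_sub"
  by (simp add: universal_whittaker_def extend_scalars_def tensor_sub_def)

lemma T_fields:
  "carrier T = {x. Poly_Mapping.keys x \<subseteq> range cl \<times> UNIV}" "add T = (+)" "ring.zero T = 0"
  "s \<odot>\<^bsub>T\<^esub> x = frag_extend (\<lambda>(s', n). frag_of (s \<otimes>\<^bsub>U\<^esub> s', n)) x"
  by (auto simp: tensor_free_def mk_module_fields cl_U(1) whittaker_line_fields free_Abelian_group_def)

lemma T_closed:
  "x \<in> carrier T \<Longrightarrow> y \<in> carrier T \<Longrightarrow> x + y \<in> carrier T"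
  "x \<in> carrier T \<Longrightarrow> y \<in> carrier T \<Longrightarrow> x - y \<in> carrier T"
  "x \<in> carrier T \<Longrightarrow> - x \<in> carrier T" "0 \<in> carrier T" "frag_of (cl p, c) \<in> carrier T"
  using keys_add[of x y] keys_diff[of x y] by (auto simp: T_fields)

lemma T_smult: "cl p \<odot>\<^bsub>T\<^esub> frag_of (cl q, c) = frag_of (cl (p * q), c)"
  "s \<odot>\<^bsub>T\<^esub> (x + y) = s \<odot>\<^bsub>T\<^esub> x + s \<odot>\<^bsub>T\<^esub> y" "s \<odot>\<^bsub>T\<^esub> (x - y) = s \<odot>\<^bsub>T\<^esub> x - s \<odot>\<^bsub>T\<^esub> y"
  "s \<odot>\<^bsub>T\<^esub> 0 = 0" "s \<odot>\<^bsub>T\<^esub> (- x) = - (s \<odot>\<^bsub>T\<^esub> x)"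
  by (simp_all add: T_fields cl_U frag_extend_add frag_extend_diff frag_extend_minus)

lemma T_induct [consumes 1, case_names zero of diff]:
  assumes "x \<in> carrier T" "Q 0" "\<And>p c. Q (frag_of (cl p, c))" "\<And>x y. x \<in> carrier T \<Longrightarrow> y \<in> carrier T \<Longrightarrow> Q x \<Longrightarrow> Q y \<Longrightarrow> Q (x - y)"
  shows "Q x"
proof -
  have "x \<in> carrier T \<and> Q x"
    using assms(1)[unfolded T_fields(1) mem_Collect_eq]
  proof (induction rule: frag_induction)
    case (one k)
    then show ?case using assms(3) by (cases k) (auto simp: T_fields(1))
  qed (use assms T_closed in auto)
  then show ?thesis ..
qed

lemma T_smult_closed: "x \<in> carrier T \<Longrightarrow> cl p \<odot>\<^bsub>T\<^esub> x \<in> carrier T"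
  by (induction rule: T_induct) (auto simp only: T_smult T_closed)

lemma abelian_group_T: "abelian_group T"
  by (rule abelian_groupI)
    (auto simp: T_closed T_fields(2,3) add_ac intro!: bexI[of _ "- x" for x])

lemma T_minus: "x \<in> carrier T \<Longrightarrow> y \<in> carrier T \<Longrightarrow> x \<ominus>\<^bsub>T\<^esub> y = x - y"
proof -
  interpret abelian_group T by (rule abelian_group_T)
  assume "x \<in> carrier T" "y \<in> carrier T"
  moreover from this have "\<ominus>\<^bsub>T\<^esub> y = - y" by (intro minus_equality) (simp_all add: T_fields(2,3) T_closed)
  ultimately show ?thesis by (simp add: a_minus_def T_fields(2))
qed

lemma tensor_relators_cases:
  assumes "x \<in> relators"
  obtains (left) p q c where "x = frag_of (cl (p + q), c) - (frag_of (cl p, c) + frag_of (cl q, c))"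
  | (right) p a b where "x = frag_of (cl p, a + b) - (frag_of (cl p, a) + frag_of (cl p, b))"
  | (balanced) p r c where "x = frag_of (cl (p * r), c) - frag_of (cl p, char_eval \<psi> r * c)"
      "r \<in> carrier (free_algebra (carrier n_plus))"
  using assms
  by (auto simp: tensor_relators_def cl_U(1-3) carrier_uea_n_plus whittaker_line_fields uea_inclusion_class
      whittaker_line_smult)

lemma tensor_relators_mem:
  "frag_of (cl (p + q), c) - (frag_of (cl p, c) + frag_of (cl q, c)) \<in> relators"
  "frag_of (cl p, a + b) - (frag_of (cl p, a) + frag_of (cl p, b)) \<in> relators"
  "r \<in> carrier (free_algebra (carrier n_plus)) \<Longrightarrow>
   frag_of (cl (p * r), c) - frag_of (cl p, char_eval \<psi> r * c) \<in> relators"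
proof -
  show "frag_of (cl (p + q), c) - (frag_of (cl p, c) + frag_of (cl q, c)) \<in> relators"
    unfolding tensor_relators_def whittaker_line_fields cl_U(1) cl_U(2)[symmetric] by blast
  show "frag_of (cl p, a + b) - (frag_of (cl p, a) + frag_of (cl p, b)) \<in> relators"
    unfolding tensor_relators_def whittaker_line_fields cl_U(1) by blast
  assume "r \<in> carrier (free_algebra (carrier n_plus))"
  then show "frag_of (cl (p * r), c) - frag_of (cl p, char_eval \<psi> r * c) \<in> relators"
    unfolding tensor_relators_def whittaker_line_fields cl_U(1) cl_U(3)[symmetric] carrier_uea_n_plus
      whittaker_line_smult[symmetric] uea_inclusion_class[of r, symmetric] by blast
qed

lemma tensor_sub_induct [consumes 1, case_names zero relator neg add]:
  assumes "x \<in> tensor_sub" "Q 0"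
    and "\<And>x. x \<in> relators \<Longrightarrow> Q x"
    and "\<And>x. x \<in> carrier T \<Longrightarrow> Q x \<Longrightarrow> Q (- x)"
    and "\<And>x y. Q x \<Longrightarrow> Q y \<Longrightarrow> Q (x + y)"
  shows "Q x"
proof -
  have rel: "x \<in> carrier T" if "x \<in> relators" for x
    using that by (cases rule: tensor_relators_cases) (auto intro!: T_closed)
  show ?thesis using assms(1) unfolding tensor_sub_def
  proof (induction rule: generate.induct)
    case (inv h)
    then have "inv\<^bsub>free_Abelian_group (carrier U \<times> carrier (whittaker_line \<psi>))\<^esub> h = - h"
      using rel[OF inv] by (intro inv_free_Abelian_group) (simp add: T_fields cl_U(1) whittaker_line_fields)
    then show ?case using assms(3,4) rel inv by simp
  qed (use assms in simp_all)
qed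

lemma tensor_sub_T: "x \<in> tensor_sub \<Longrightarrow> x \<in> carrier T"
proof (induction rule: tensor_sub_induct)
  case (relator x)
  then show ?case by (cases rule: tensor_relators_cases) (auto intro!: T_closed)
qed (auto intro: T_closed)

lemma tensor_sub_relators: "x \<in> relators \<Longrightarrow> x \<in> tensor_sub"
  unfolding tensor_sub_def by (rule generate.incl)

lemma tensor_sub_closed: "0 \<in> tensor_sub" "x \<in> tensor_sub \<Longrightarrow> y \<in> tensor_sub \<Longrightarrow> x + y \<in> tensor_sub" "x \<in> tensor_sub \<Longrightarrow> - x \<in> tensor_sub"
proof -
  let ?F = "free_Abelian_group (carrier U \<times> carrier (whittaker_line \<psi>))"
  have F: "carrier ?F = carrier T"
    by (auto simp: T_fields cl_U(1) whittaker_line_fields)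
  have sub: "relators \<subseteq> carrier ?F"
    using tensor_sub_T[OF tensor_sub_relators] unfolding F by blast
  show "0 \<in> tensor_sub" using generate.one[of ?F] unfolding tensor_sub_def by simp
  show "x + y \<in> tensor_sub" if "x \<in> tensor_sub" "y \<in> tensor_sub"
    using generate.eng[of x ?F _ y] that unfolding tensor_sub_def by simp
  show "- x \<in> tensor_sub" if x: "x \<in> tensor_sub"
    using group.generate_m_inv_closed[OF group_free_Abelian_group sub, of x] inv_free_Abelian_group[of x] x tensor_sub_T[OF x]
    unfolding tensor_sub_def by (simp add: F[symmetric])
qed

lemma tensor_sub_smult: "x \<in> tensor_sub \<Longrightarrow> cl s \<odot>\<^bsub>T\<^esub> x \<in> tensor_sub"
proof (induction rule: tensor_sub_induct)
  case (relator x)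
  then show ?case
  proof (cases rule: tensor_relators_cases)
    case (left p q c)
    then show ?thesis using tensor_sub_relators[OF tensor_relators_mem(1)[of "s * p" "s * q" c]]
      by (simp only: T_smult distrib_left)
  next
    case (right p a b)
    then show ?thesis using tensor_sub_relators[OF tensor_relators_mem(2)[of "s * p" a b]] by (simp only: T_smult)
  next
    case (balanced p r c)
    then show ?thesis using tensor_sub_relators[OF tensor_relators_mem(3)[of r "s * p" c]] by (simp only: T_smult mult.assoc)
  qed
qed (simp_all only: T_smult tensor_sub_closed)

sublocale MQ: quotient_module tensor_sub T "range cl"
proof -
  have "subgroup tensor_sub (add_monoid T)"
  proof (rule group.subgroupI[OF abelian_group.a_group[OF abelian_group_T]])
    interpret abelian_group T by (rule abelian_group_T)
    show "inv\<^bsub>add_monoid T\<^esub> x \<in> tensor_sub" if x: "x \<in> tensor_sub" for x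
    proof -
      have "\<ominus>\<^bsub>T\<^esub> x = - x"
        by (intro minus_equality) (simp_all add: T_fields(2,3) T_closed tensor_sub_T x)
      then show ?thesis using tensor_sub_closed(3)[OF x] by (simp add: a_inv_def)
    qed
  qed (use tensor_sub_closed tensor_sub_T in \<open>auto simp: T_fields(2)\<close>)
  then have "abelian_subgroup tensor_sub T"
    by (intro abelian_subgroupI3 additive_subgroup.intro abelian_group_T)
  then show "quotient_module tensor_sub T (range cl)"
    unfolding quotient_module_def quotient_module_axioms_def
    using T_smult_closed tensor_sub_smult T_smult(2) by (auto simp: T_fields(2))
qed

text \<open>The tensor \<open>p \<otimes> 1\<close>, which is the action of \<open>p\<close> on the generator of \<open>M\<close>.\<close>
definition tens :: "(vir free_monoid \<Rightarrow>\<^sub>0 complex) \<Rightarrow> ((vir_uea \<times> complex) \<Rightarrow>\<^sub>0 int) set"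
  where "tens p = tensor_sub +>\<^bsub>T\<^esub> frag_of (cl p, 1)"

text \<open>\<open>p \<otimes> c = p c \<otimes> 1\<close>: scalars belong to the image of \<open>U(n\<^sup>+)\<close> and move across the tensor sign.\<close>
lemma coset_frag_of:
  "tensor_sub +>\<^bsub>T\<^esub> frag_of (cl p, c) = tens (p * free_scalar c)"
proof -
  have "frag_of (cl (p * free_scalar c), 1) - frag_of (cl p, char_eval \<psi> (free_scalar c) * 1) \<in> tensor_sub"
    by (intro tensor_sub_relators tensor_relators_mem free_algebra_basic)
  then have "- (frag_of (cl (p * free_scalar c), 1) - frag_of (cl p, c)) \<in> tensor_sub"
    by (intro tensor_sub_closed) (simp add: char_eval_simps)
  then show ?thesis
    unfolding tens_def by (subst MQ.quot_eq) (simp_all add: T_closed T_minus)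
qed

lemma tens_add: "tens p \<oplus>\<^bsub>M\<^esub> tens q = tens (p + q)"
proof -
  have "- (frag_of (cl (p + q), 1) - (frag_of (cl p, 1) + frag_of (cl q, 1))) \<in> tensor_sub"
    by (intro tensor_sub_closed tensor_sub_relators tensor_relators_mem)
  then have "tensor_sub +>\<^bsub>T\<^esub> (frag_of (cl p, 1) + frag_of (cl q, 1)) = tensor_sub +>\<^bsub>T\<^esub> frag_of (cl (p + q), 1)"
    by (subst MQ.quot_eq) (simp_all add: T_closed T_minus)
  then show ?thesis by (simp add: tens_def M_eq MQ.quot_add T_closed T_fields(2))
qed

lemma tens_smult: "cl p \<odot>\<^bsub>M\<^esub> tens q = tens (p * q)"
  by (simp only: tens_def M_eq MQ.quot_smult rangeI T_closed T_smult)

lemma tens_0: "tens 0 = \<zero>\<^bsub>M\<^esub>"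
proof -
  interpret Q: abelian_group M unfolding M_eq by (rule MQ.quot_abelian_group)
  have "tens 0 \<in> carrier M" by (auto simp: tens_def M_eq MQ.quot_carrier T_closed)
  then show ?thesis using tens_add[of 0 0] by simp
qed

text \<open>Every sum of tensors \<open>p \<otimes> c\<close> can be collected into a single tensor \<open>p \<otimes> 1\<close>.\<close>
lemma carrier_M: "carrier M = range tens"
proof -
  have "tensor_sub +>\<^bsub>T\<^esub> x \<in> range tens" if "x \<in> carrier T" for x
    using that
  proof (induction rule: T_induct)
    case zero
    have "tensor_sub +>\<^bsub>T\<^esub> 0 = tens 0"
      using MQ.quot_eq_zero[of 0] tensor_sub_closed(1) tens_0 by (simp add: M_eq MQ.quot_zero T_closed)
    then show ?case by simp
  next
    case (of p c)
    then show ?case by (simp add: coset_frag_of)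
  next
    case (diff x y)
    then obtain p q where pq: "tensor_sub +>\<^bsub>T\<^esub> x = tens p" "tensor_sub +>\<^bsub>T\<^esub> y = tens q" by auto
    interpret Q: abelian_group M unfolding M_eq by (rule MQ.quot_abelian_group)
    have carr: "tensor_sub +>\<^bsub>T\<^esub> z \<in> carrier M" if "z \<in> carrier T" for z
      using that by (auto simp: M_eq MQ.quot_carrier)
    have "(tensor_sub +>\<^bsub>T\<^esub> (x - y)) \<oplus>\<^bsub>M\<^esub> tens q = tensor_sub +>\<^bsub>T\<^esub> ((x - y) + y)"
      using diff MQ.quot_add[of "x - y" y] by (simp add: M_eq T_closed T_fields(2) flip: pq)
    also have "\<dots> = tens (p - q) \<oplus>\<^bsub>M\<^esub> tens q" by (simp add: tens_add pq)
    finally have "tensor_sub +>\<^bsub>T\<^esub> (x - y) = tens (p - q)"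
      using carr diff T_closed by (simp add: tens_def)
    then show ?case by simp
  qed
  then show ?thesis by (auto simp: M_eq MQ.quot_carrier tens_def T_closed)
qed

section \<open>The quotient by the central element\<close>

lemma tens_closed: "tens p \<in> carrier M"
  by (simp add: carrier_M)

lemma abelian_group_M: "abelian_group M"
  unfolding M_eq by (rule MQ.quot_abelian_group)

lemma tens_minus: "tens p \<ominus>\<^bsub>M\<^esub> tens q = tens (p - q)"
proof -
  interpret abelian_group M by (rule abelian_group_M)
  have "\<ominus>\<^bsub>M\<^esub> tens q = tens (- q)" by (intro minus_equality) (simp_all add: tens_closed tens_add tens_0)
  then show ?thesis by (simp add: a_minus_def tens_add)
qed

lemma tens_cong: "p - q \<in> uea_ideal virasoro \<Longrightarrow> tens p = tens q"
  using cl_eq[of p q] by (simp add: tens_def)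

definition z_image :: "complex \<Rightarrow> ((vir_uea \<times> complex) \<Rightarrow>\<^sub>0 int) set set"
  where "z_image \<xi> = range (\<lambda>p. tens ((free_gen vir_z - free_scalar \<xi>) * p))"

lemma whittaker_quotient_eq: "whittaker_quotient \<psi> \<xi> = quot_module M (z_image \<xi>)"
  by (simp add: whittaker_quotient_def z_image_def carrier_M image_image z_minus_def cl_U tens_smult)

lemma tens_zeta_commute: "tens (s * ((free_gen vir_z - free_scalar \<xi>) * p)) = tens ((free_gen vir_z - free_scalar \<xi>) * (s * p))"
proof (rule tens_cong)
  have "- ((free_gen vir_z * s - s * free_gen vir_z) * p) \<in> uea_ideal virasoro"
    by (intro uea_ideal_vir vir_z_central)
  moreover have "free_scalar \<xi> * (s * p) = s * (free_scalar \<xi> * p)"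
    by (metis free_scalar_commute mult.assoc)
  ultimately show "s * ((free_gen vir_z - free_scalar \<xi>) * p) - (free_gen vir_z - free_scalar \<xi>) * (s * p) \<in> uea_ideal virasoro"
    by (simp add: algebra_simps)
qed

lemma quotient_module_z_image: "quotient_module (z_image \<xi>) M (range cl)"
proof -
  interpret abelian_group M by (rule abelian_group_M)
  let ?z = "free_gen vir_z - free_scalar \<xi>"
  have "subgroup (z_image \<xi>) (add_monoid M)"
  proof (rule group.subgroupI[OF a_group])
    fix x y assume x: "x \<in> z_image \<xi>" and y: "y \<in> z_image \<xi>"
    then obtain p q where pq: "x = tens (?z * p)" "y = tens (?z * q)" by (auto simp: z_image_def)
    have "\<ominus>\<^bsub>M\<^esub> x = tens (?z * (- p))"
      unfolding pq by (intro minus_equality) (simp_all add: tens_closed tens_add tens_0)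
    then have "\<ominus>\<^bsub>M\<^esub> x \<in> z_image \<xi>" unfolding z_image_def by blast
    then show "inv\<^bsub>add_monoid M\<^esub> x \<in> z_image \<xi>" by (simp add: a_inv_def)
    show "x \<otimes>\<^bsub>add_monoid M\<^esub> y \<in> z_image \<xi>"
      using pq by (auto simp: z_image_def tens_add simp flip: distrib_left)
  qed (auto simp: z_image_def tens_closed)
  then have "abelian_subgroup (z_image \<xi>) M"
    by (intro abelian_subgroupI3 additive_subgroup.intro abelian_group_M)
  then show ?thesis
    unfolding quotient_module_def quotient_module_axioms_def
    by (auto simp: carrier_M tens_smult tens_add distrib_left z_image_def tens_zeta_commute)
qed

text \<open>If \<open>n\<^sup>+\<close> acts on \<open>f\<close> by \<open>\<psi>\<close>, then every element of its free algebra acts by a scalar. This is the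
  tensor relation over \<open>U(n\<^sup>+)\<close>, expressed in functions of words.\<close>
lemma rep_n_plus:
  assumes f: "\<And>x u. x \<in> carrier n_plus \<Longrightarrow> vir_act x f u = \<psi> x * f u"
    and r: "r \<in> carrier (free_algebra (carrier n_plus))"
  shows "rep r f = rep (free_scalar (char_eval \<psi> r)) f"
proof
  fix u
  have word: "foldr vir_act l f = (\<lambda>u. prod_list (map \<psi> l) * f u)" if "set l \<subseteq> carrier n_plus" for l
    using that
  proof (induction l)
    case (Cons x l)
    then have "foldr vir_act (x # l) f = vir_act x (\<lambda>u. prod_list (map \<psi> l) * f u)" by simp
    also have "\<dots> = (\<lambda>u. prod_list (map \<psi> l) * vir_act x f u)" by (simp add: vir_act_def lin_fun_mult fun_eq_iff)
    finally show ?case using Cons f by (simp add: mult_ac)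
  qed simp
  have "rep r f u = lin (\<lambda>w. f u * prod_list (map \<psi> (letters w))) r"
    unfolding rep_def using r by (intro lin_cong refl) (auto simp: free_algebra_fields word)
  then show "rep r f u = rep (free_scalar (char_eval \<psi> r)) f u"
    by (simp add: lin_fun_mult rep_simps char_eval_def)
qed

text \<open>The generator of the quotient is not zero. The pairing \<open>p \<otimes> c \<mapsto> c f(p)\<close> with the Whittaker functional is
  defined on the tensor product, it is 1 on \<open>1 \<otimes> 1\<close>, and it vanishes on \<open>(z - \<xi>) M\<close> because \<open>z\<close> can be moved to the
  right, where it acts on \<open>f\<close> as \<open>\<xi>\<close>.\<close>
lemma one_notin_z_image: "tens 1 \<notin> z_image \<xi>"
proof
  assume "tens 1 \<in> z_image \<xi>"
  let ?z = "free_gen vir_z - free_scalar \<xi>"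
  obtain p where p: "tens 1 = tens (?z * p)" using \<open>tens 1 \<in> z_image \<xi>\<close> by (auto simp: z_image_def)
  obtain f where f: "f [] = 1" "f \<in> uea_dual" "\<And>x u. x \<in> carrier n_plus \<Longrightarrow> vir_act x f u = \<psi> x * f u"
    "\<And>u. vir_act vir_z f u = \<xi> * f u"
    using whittaker_functional_exists[of \<xi>] by metis
  define F where "F p = rep p f []" for p
  have F_cong: "F p = F q" if "p - q \<in> uea_ideal virasoro" for p q
    using rep_uea_ideal[OF that f(2)] rep_simps(2)[of p q f "[]"] by (simp add: F_def)
  define h where "h = (\<lambda>(P, c). c * F (SOME p. cl p = P))"
  have h: "h (cl p, c) = c * F p" for p c
  proof -
    have "cl (SOME q. cl q = cl p) = cl p" by (rule someI) simp
    then show ?thesis by (simp add: h_def cl_eq F_cong)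
  qed
  \<comment> \<open>The pairing is well defined on the tensor product.\<close>
  have "frag_sum h x = 0" if "x \<in> tensor_sub" for x
    using that
  proof (induction rule: tensor_sub_induct)
    case (relator x)
    then show ?case
    proof (cases rule: tensor_relators_cases)
      case (balanced p r c)
      have "F (p * r) = rep p (rep (free_scalar (char_eval \<psi> r)) f) []"
        by (simp add: F_def rep_times rep_n_plus[OF f(3) balanced(2)])
      also have "\<dots> = F (free_scalar (char_eval \<psi> r) * p)"
        by (simp add: F_def free_scalar_commute flip: rep_times)
      also have "\<dots> = char_eval \<psi> r * F p" by (simp add: F_def rep_times rep_simps)
      finally show ?thesis by (simp add: balanced frag_sum_simps h)
    next
      case (left p q c)
      show ?thesis unfolding left by (simp add: frag_sum_simps frag_sum_add h F_def rep_simps distrib_left)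
    next
      case (right p a b)
      show ?thesis unfolding right by (simp add: frag_sum_simps frag_sum_add h distrib_right)
    qed
  next
    case (neg x)
    then show ?case using frag_sum_simps(3)[of h 0 x] by (simp add: frag_sum_simps)
  qed (simp_all add: frag_sum_simps frag_sum_add)
  moreover have "frag_of (cl 1, 1) - frag_of (cl (?z * p), 1) \<in> tensor_sub"
    using p unfolding tens_def by (subst (asm) MQ.quot_eq) (simp_all add: T_closed T_minus)
  ultimately have "F 1 = F (?z * p)" by (metis frag_sum_simps(2,3) h mult_1 right_minus_eq)
  also have "\<dots> = F (p * ?z)"
  proof (rule F_cong)
    show "?z * p - p * ?z \<in> uea_ideal virasoro"
      using vir_z_central[of p] by (simp add: algebra_simps free_scalar_commute)
  qed
  also have "rep ?z f = (\<lambda>u. 0)" by (simp add: fun_eq_iff rep_simps f(4))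
  then have "F (p * ?z) = 0" by (simp add: F_def rep_times rep_zero_fun)
  finally show False using f(1) by (simp add: F_def rep_1)
qed

text \<open>The annihilator of the generator of the quotient \<open>M / (z - \<xi>) M\<close>, as a left ideal of the free algebra.\<close>
definition ann :: "complex \<Rightarrow> (vir free_monoid \<Rightarrow>\<^sub>0 complex) set"
  where "ann \<xi> = {p. tens p \<in> z_image \<xi>}"

lemma ann_closed:
  "p \<in> uea_ideal virasoro \<Longrightarrow> p \<in> ann \<xi>"
  "p \<in> ann \<xi> \<Longrightarrow> q \<in> ann \<xi> \<Longrightarrow> p + q \<in> ann \<xi>"
  "p \<in> ann \<xi> \<Longrightarrow> s * p \<in> ann \<xi>"
  "(free_gen vir_z - free_scalar \<xi>) * p \<in> ann \<xi>"
  "x \<in> carrier n_plus \<Longrightarrow> free_gen x - free_scalar (\<psi> x) \<in> ann \<xi>"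
  "1 \<notin> ann \<xi>"
proof -
  interpret Q: quotient_module "z_image \<xi>" M "range cl" by (rule quotient_module_z_image)
  have zero: "p \<in> ann \<xi>" if "tens p = tens 0" for p
    using that Q.zero_closed by (simp add: ann_def tens_0)
  show "p \<in> ann \<xi>" if "p \<in> uea_ideal virasoro"
    by (rule zero, rule tens_cong) (use that in simp)
  show "p + q \<in> ann \<xi>" if "p \<in> ann \<xi>" "q \<in> ann \<xi>"
    using additive_subgroup.a_closed[OF Q.is_additive_subgroup, of "tens p" "tens q"] that by (simp add: ann_def tens_add)
  show "s * p \<in> ann \<xi>" if "p \<in> ann \<xi>"
    using Q.smult_sub[of "cl s" "tens p"] that by (simp add: ann_def tens_smult)
  show "(free_gen vir_z - free_scalar \<xi>) * p \<in> ann \<xi>" by (simp add: ann_def z_image_def)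
  show "1 \<notin> ann \<xi>" using one_notin_z_image by (simp add: ann_def)
  show "free_gen x - free_scalar (\<psi> x) \<in> ann \<xi>" if x: "x \<in> carrier n_plus"
  proof (rule zero)
    have "frag_of (cl (1 * free_gen x), 1) - frag_of (cl 1, char_eval \<psi> (free_gen x) * 1) \<in> tensor_sub"
      by (intro tensor_sub_relators tensor_relators_mem free_algebra_basic x)
    then have "tens (free_gen x) = tensor_sub +>\<^bsub>T\<^esub> frag_of (cl 1, \<psi> x)"
      unfolding tens_def by (subst MQ.quot_eq) (simp_all add: T_closed T_minus char_eval_simps)
    then have eq: "tens (free_gen x) = tens (free_scalar (\<psi> x))" by (simp add: coset_frag_of)
    have "tens (free_gen x - free_scalar (\<psi> x)) = tens (free_scalar (\<psi> x)) \<ominus>\<^bsub>M\<^esub> tens (free_scalar (\<psi> x))"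
      by (simp only: tens_minus[symmetric] eq)
    then show "tens (free_gen x - free_scalar (\<psi> x)) = tens 0" by (simp add: tens_minus)
  qed
qed

lemma whittaker_data_free_algebra:
  assumes "\<psi> (vir_d 2) \<noteq> 0"
  shows "whittaker_data (\<lambda>c p. free_scalar c * p) (ann \<xi>) (\<lambda>k p. free_gen (vir_d k) * p) 1 (\<lambda>k. \<psi> (vir_d k)) \<xi>"
proof -
  interpret vector_space "\<lambda>c p. free_scalar c * (p :: vir free_monoid \<Rightarrow>\<^sub>0 complex)"
    by standard (simp_all add: free_scalar_simps distrib_left distrib_right mult.assoc)
  show ?thesis
  proof
    show "subspace (ann \<xi>)"
      by (rule subspaceI) (auto intro: ann_closed uea_ideal_vir(1))
    fix k j :: int and v :: "vir free_monoid \<Rightarrow>\<^sub>0 complex" and c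
    let ?g = "\<lambda>k. free_gen (vir_d k)" and ?z = "free_gen vir_z"
    show "?g k * (free_scalar c * v) = free_scalar c * (?g k * v)"
      by (metis free_scalar_commute mult.assoc)
    show "v \<in> ann \<xi> \<Longrightarrow> ?g k * v \<in> ann \<xi>" by (rule ann_closed)
    show "?g k * (?g j * v) - ?g j * (?g k * v) -
        (free_scalar (of_int (j - k)) * (?g (k + j) * v) +
         (if j = - k then free_scalar ((of_int k ^ 3 - of_int k) / 12 * \<xi>) * v else 0)) \<in> ann \<xi>"
    proof -
      define a where "a = complex_of_int (j - k)"
      define b where "b = (if j = - k then (complex_of_int k ^ 3 - of_int k) / 12 else 0)"
      have br: "vir_bracket (vir_d k) (vir_d j) = vir_scale a (vir_d (k + j)) + vir_scale b vir_z"
        by (simp add: vir_bracket_basis a_def b_def vir_scale_simps)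
      let ?X = "vir_scale a (vir_d (k + j))" and ?Y = "vir_scale b vir_z"
      note uea_ideal_vir(2)[OF uea_ideal_vir(2)[OF uea_ideal_vir(2)[OF
          uea_relations(3)[of "vir_d k" "vir_d j", unfolded br] uea_relations(1)[of ?X ?Y]]
          uea_relations(2)[of a "vir_d (k + j)"]] uea_relations(2)[of b vir_z]]
      then have "(?g k * ?g j - ?g j * ?g k - free_scalar a * ?g (k + j) - free_scalar b * ?z) * v \<in> ann \<xi>"
        by (intro ann_closed(1) uea_ideal_vir(6)) (simp add: algebra_simps)
      then have "(?g k * ?g j - ?g j * ?g k - free_scalar a * ?g (k + j) - free_scalar b * ?z) * v
          + free_scalar b * ((?z - free_scalar \<xi>) * v) \<in> ann \<xi>"
        by (rule ann_closed(2)[OF _ ann_closed(3)[OF ann_closed(4)]])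
      moreover have "(if j = - k then free_scalar ((of_int k ^ 3 - of_int k) / 12 * \<xi>) * v else 0)
          = free_scalar (b * \<xi>) * v"
        by (simp add: b_def free_scalar_simps(3))
      moreover have "?g k * (?g j * v) - ?g j * (?g k * v) - (free_scalar a * (?g (k + j) * v) + free_scalar (b * \<xi>) * v)
          = (?g k * ?g j - ?g j * ?g k - free_scalar a * ?g (k + j) - free_scalar b * ?z) * v
            + free_scalar b * ((?z - free_scalar \<xi>) * v)"
        by (simp only: free_scalar_simps(2) left_diff_distrib right_diff_distrib mult.assoc) simp
      ultimately show ?thesis by (simp only: a_def[symmetric])
    qed
    show "?g k * 1 - free_scalar (\<psi> (vir_d k)) * 1 \<in> ann \<xi>" if "k \<ge> 1"
      using ann_closed(5)[OF vir_d_n_plus[OF that]] by simp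
    show "\<psi> (vir_d k) = 0" if "k \<ge> 3" by (rule psi_d_ge_3[OF that])
  qed (use assms in \<open>simp_all add: distrib_left\<close>)
qed

text \<open>The quotient of the free algebra by \<open>ann\<close> satisfies \<open>whittaker_data\<close>. It remains to see that the
  filtration exhausts the free algebra: the operators \<open>d k\<close>, the scalar \<open>z \<equiv> \<xi>\<close> and
  linear combinations of these account for all letters.\<close>
lemma left_ideal_contains_1:
  assumes "\<psi> (vir_d 2) \<noteq> 0"
    and I: "0 \<in> I" "\<And>p q. p \<in> I \<Longrightarrow> q \<in> I \<Longrightarrow> p + q \<in> I" "\<And>c p. p \<in> I \<Longrightarrow> free_scalar c * p \<in> I"
      "\<And>x p. p \<in> I \<Longrightarrow> free_gen x * p \<in> I"
    and "ann \<xi> \<subseteq> I" "p \<in> I" "p \<notin> ann \<xi>"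
  shows "1 \<in> I"
proof -
  interpret W: whittaker_data "\<lambda>c p. free_scalar c * p" "ann \<xi>" "\<lambda>k p. free_gen (vir_d k) * p" 1 "\<lambda>k. \<psi> (vir_d k)" \<xi>
    by (rule whittaker_data_free_algebra[OF assms(1)])
  have ideal: "r \<in> W.Fil N" if "r \<in> uea_ideal virasoro" for r N
    by (intro W.J_Fil ann_closed that)
  have gen_Fil: "\<exists>N. free_gen x * q \<in> W.Fil N" if q: "q \<in> W.Fil N" for x q N
  proof (induction x rule: vir_basis_induct)
    case (1 a)
    show ?case
    proof (cases a)
      case Z
      have "(free_gen vir_z - free_scalar \<xi>) * q + free_scalar \<xi> * q \<in> W.Fil N"
        by (intro W.Fil_add W.Fil_scale q W.J_Fil ann_closed)
      then show ?thesis by (auto simp: Z vir_z_def algebra_simps)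
    next
      case (D k)
      then show ?thesis using W.d_Fil[OF q, of k] by (simp add: vir_d_def)
    qed
  next
    case (2 x y)
    then obtain N1 N2 where N: "free_gen x * q \<in> W.Fil N1" "free_gen y * q \<in> W.Fil N2" by auto
    have "(free_gen (x + y) - (free_gen x + free_gen y)) * q + (free_gen x * q + free_gen y * q) \<in> W.Fil (max N1 N2)"
      by (intro W.Fil_add ideal uea_ideal_vir uea_relations W.Fil_mono[OF N(1)] W.Fil_mono[OF N(2)]) simp_all
    then show ?case by (auto simp: algebra_simps)
  next
    case (3 c x)
    then obtain N1 where N: "free_gen x * q \<in> W.Fil N1" by auto
    have "(free_gen (vir_scale c x) - free_scalar c * free_gen x) * q + free_scalar c * (free_gen x * q) \<in> W.Fil N1"
      by (intro W.Fil_add ideal uea_ideal_vir uea_relations W.Fil_scale N)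
    then show ?case by (auto simp: algebra_simps)
  qed
  have "\<exists>N. q \<in> W.Fil N" for q
  proof (induction q rule: free_algebra_induct)
    case (scalar c)
    have "free_scalar c * 1 \<in> W.Fil 0" using W.mon_Fil[of "[]" 0] by (intro W.Fil_scale) simp
    then show ?case by auto
  next
    case (gen x p)
    then show ?case using gen_Fil[of p _ x] by auto
  next
    case (add p q)
    then obtain N1 N2 where "p \<in> W.Fil N1" "q \<in> W.Fil N2" by auto
    then have "p + q \<in> W.Fil (max N1 N2)"
      by (intro W.Fil_add) (auto elim: W.Fil_mono)
    then show ?case ..
  qed
  then obtain N where "p \<in> W.Fil N" by blast
  moreover have "W.subspace I" by (intro W.subspaceI I)
  ultimately show ?thesis using W.w_in_invariant_subspace[of I p N] I assms by auto
qed

text \<open>The map \<open>\<Phi> p = p \<otimes> 1 + (z - \<xi>) M\<close> from the free algebra is onto and has kernel \<open>ann\<close>. All structure of the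
  module is read off on representatives, and a submodule \<open>N\<close> becomes the left ideal \<open>\<Phi>\<^sup>-\<^sup>1 N\<close>.\<close>
lemma simple_whittaker_quotient:
  assumes "\<psi> (vir_d 2) \<noteq> 0"
  shows "simple_lie_module virasoro
    (lie_space virasoro (whittaker_quotient \<psi> \<xi>)) (lie_act virasoro (whittaker_quotient \<psi> \<xi>))"
proof -
  let ?L = "lie_space virasoro (whittaker_quotient \<psi> \<xi>)" and ?act = "lie_act virasoro (whittaker_quotient \<psi> \<xi>)"
  interpret Q: quotient_module "z_image \<xi>" M "range cl" by (rule quotient_module_z_image)
  define \<Phi> where "\<Phi> p = z_image \<xi> +>\<^bsub>M\<^esub> tens p" for p
  have L: "carrier ?L = range \<Phi>" "\<zero>\<^bsub>?L\<^esub> = z_image \<xi>"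
    by (auto simp: lie_space_def mk_module_fields whittaker_quotient_eq Q.quot_carrier Q.quot_zero carrier_M \<Phi>_def)
  have add: "\<Phi> p \<oplus>\<^bsub>?L\<^esub> \<Phi> q = \<Phi> (p + q)" for p q
    by (simp add: lie_space_def mk_module_fields whittaker_quotient_eq Q.quot_add tens_closed tens_add \<Phi>_def)
  have smult: "c \<odot>\<^bsub>?L\<^esub> \<Phi> p = \<Phi> (free_scalar c * p)" for c p
    by (simp add: lie_space_def mk_module_fields whittaker_quotient_eq Q.quot_smult tens_closed tens_smult \<Phi>_def)
  have act: "?act x (\<Phi> p) = \<Phi> (free_gen x * p)" for x p
    by (simp add: lie_act_def whittaker_quotient_eq Q.quot_smult tens_closed tens_smult \<Phi>_def)
  have eq: "\<Phi> p = \<Phi> q \<longleftrightarrow> p - q \<in> ann \<xi>" for p q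
    by (simp add: \<Phi>_def Q.quot_eq tens_closed tens_minus ann_def)
  have zero: "\<Phi> p = \<zero>\<^bsub>?L\<^esub> \<longleftrightarrow> p \<in> ann \<xi>" for p
    by (simp add: L \<Phi>_def Q.quot_eq_zero tens_closed ann_def)
  have eqI: "\<Phi> p = \<Phi> q" if "p - q \<in> uea_ideal virasoro" for p q
    by (simp add: eq ann_closed that)
  have zero_eq: "\<zero>\<^bsub>?L\<^esub> = \<Phi> 0"
    using zero[of 0] by (simp add: ann_closed(1) uea_ideal_vir(1))
  have ag: "abelian_group ?L"
    by (rule abelian_groupI) (auto simp: L(1) add zero_eq add_ac, metis add.right_inverse)
  then interpret L: abelian_group ?L .
  have minus: "\<Phi> p \<ominus>\<^bsub>?L\<^esub> \<Phi> q = \<Phi> (p - q)" for p q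
  proof -
    have "\<ominus>\<^bsub>?L\<^esub> \<Phi> q = \<Phi> (- q)"
      by (intro L.minus_equality) (simp_all add: L(1) add, simp add: zero ann_closed uea_ideal_vir)
    then show ?thesis by (simp add: a_minus_def add)
  qed
  have module: "module complex_ring ?L"
    by (rule moduleI[OF cring_complex_ring ag])
      (auto simp: L(1) smult add ring_of_type_algebra_def free_scalar_simps distrib_left distrib_right mult.assoc)
  have lie_module: "lie_module virasoro ?L ?act"
    unfolding lie_module_def
  proof (intro conjI lie_algebra_virasoro module)
    show "lie_module_axioms virasoro ?L ?act"
    proof
      fix x y :: vir and v w c
      assume "v \<in> carrier ?L"
      then obtain p where v: "v = \<Phi> p" by (auto simp: L)
      show "?act x v \<in> carrier ?L" by (simp add: v act L)
      show "?act (x \<oplus>\<^bsub>virasoro\<^esub> y) v = ?act x v \<oplus>\<^bsub>?L\<^esub> ?act y v"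
        unfolding v act add vir_fields distrib_right[symmetric]
        by (rule eqI) (simp add: uea_ideal_vir uea_relations flip: left_diff_distrib)
      show "?act (c \<odot>\<^bsub>virasoro\<^esub> x) v = c \<odot>\<^bsub>?L\<^esub> ?act x v"
        unfolding v act smult vir_fields mult.assoc[symmetric]
        by (rule eqI) (simp add: uea_ideal_vir uea_relations flip: left_diff_distrib)
      show "?act x (c \<odot>\<^bsub>?L\<^esub> v) = c \<odot>\<^bsub>?L\<^esub> ?act x v"
        unfolding v act smult by (metis free_scalar_commute mult.assoc)
      have "- ((free_gen x * free_gen y - free_gen y * free_gen x - free_gen (vir_bracket x y)) * p) \<in> uea_ideal virasoro"
        by (intro uea_ideal_vir uea_relations)
      then show "?act (lie_bracket virasoro x y) v = ?act x (?act y v) \<ominus>\<^bsub>?L\<^esub> ?act y (?act x v)"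
        unfolding v act minus vir_fields by (intro eqI) (simp add: algebra_simps)
      assume "w \<in> carrier ?L"
      then obtain q where w: "w = \<Phi> q" by (auto simp: L)
      show "?act x (v \<oplus>\<^bsub>?L\<^esub> w) = ?act x v \<oplus>\<^bsub>?L\<^esub> ?act x w"
        by (simp add: v w act add distrib_left)
    qed
  qed
  have "N = {\<zero>\<^bsub>?L\<^esub>} \<or> N = carrier ?L" if N: "lie_submodule N virasoro ?L ?act" for N
  proof (cases "N \<subseteq> {\<zero>\<^bsub>?L\<^esub>}")
    case True
    interpret N: submodule N complex_ring ?L using N by (simp add: lie_submodule_def)
    show ?thesis using True N.one_closed by auto
  next
    case False
    interpret N: submodule N complex_ring ?L using N by (simp add: lie_submodule_def)
    define I where "I = {p. \<Phi> p \<in> N}"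
    have I: "0 \<in> I" "\<And>p q. p \<in> I \<Longrightarrow> q \<in> I \<Longrightarrow> p + q \<in> I" "\<And>c p. p \<in> I \<Longrightarrow> free_scalar c * p \<in> I"
      "\<And>x p. p \<in> I \<Longrightarrow> free_gen x * p \<in> I" "ann \<xi> \<subseteq> I"
    proof -
      have "p \<in> I" if "p \<in> ann \<xi>" for p
        using that zero[of p] N.one_closed by (simp add: I_def)
      then show "0 \<in> I" "ann \<xi> \<subseteq> I" using ann_closed(1)[OF uea_ideal_vir(1)] by auto
      show "p + q \<in> I" if "p \<in> I" "q \<in> I" for p q
        using N.m_closed[of "\<Phi> p" "\<Phi> q"] that by (simp add: I_def add)
      show "free_scalar c * p \<in> I" if "p \<in> I" for c p
        using N.smult_closed[of c "\<Phi> p"] that by (simp add: I_def smult ring_of_type_algebra_def)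
      show "free_gen x * p \<in> I" if "p \<in> I" for x p
        using N that by (auto simp: lie_submodule_def vir_fields I_def simp flip: act)
    qed
    have "N \<subseteq> carrier ?L" using N.subset by simp
    obtain x where "x \<in> N" "x \<noteq> \<zero>\<^bsub>?L\<^esub>" using False by blast
    with \<open>N \<subseteq> carrier ?L\<close> obtain p where "p \<in> I" "p \<notin> ann \<xi>"
      unfolding L(1) I_def zero[symmetric] by blast
    then have "1 \<in> I" using left_ideal_contains_1[OF assms I] by blast
    have "p \<in> I" for p
    proof (induction p rule: free_algebra_induct)
      case (scalar c)
      then show ?case using I(3)[OF \<open>1 \<in> I\<close>, of c] by simp
    qed (use I in auto)
    then have "carrier ?L \<subseteq> N" by (auto simp: L(1) I_def)
    then show ?thesis using \<open>N \<subseteq> carrier ?L\<close> by simp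
  qed
  moreover have "carrier ?L \<noteq> {\<zero>\<^bsub>?L\<^esub>}"
    using ann_closed(6) zero[of 1] by (auto simp: L(1))
  ultimately show ?thesis using lie_module by (simp add: simple_lie_module_def)
qed

end

theorem corollary4p5:
  fixes \<psi> :: "vir \<Rightarrow> complex" and \<xi> :: complex
  assumes "lie_hom n_plus complex_lie \<psi>"
    and "\<psi> (vir_d 1) \<noteq> 0"
    and "\<psi> (vir_d 2) \<noteq> 0"
  shows "simple_lie_module virasoro
    (lie_space virasoro (whittaker_quotient \<psi> \<xi>)) (lie_act virasoro (whittaker_quotient \<psi> \<xi>))"
proof -
  interpret whittaker_type \<psi> by unfold_locales (rule assms(1))
  show ?thesis by (rule simple_whittaker_quotient[OF assms(3)])
qed

end
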